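(* Let $K$ be any field. The Lie superalgebra $\mathbf R=\operatorname{Lie}(v_0,v_1)$ is just infinite; that is, $\dim_K\mathbf R=\infty$ and every nonzero ideal of $\mathbf R$ has finite codimension.
   Context: Let $\Lambda=\Lambda(x_i\mid i\ge 0)$ be the Grassmann (exterior) algebra over $K$ on odd generators $x_0,x_1,\dots$ ($x_ix_j=-x_jx_i$, $x_i^2=0$), a $\mathbb Z_2$-graded algebra; $\operatorname{End}\Lambda$ is then an associative superalgebra. Identify $x_i$ with left multiplication by $x_i$, and let $\partial_i$ be the odd superderivation of $\Lambda$ with $\partial_i(x_j)=\delta_{ij}$. The supercommutator is $[a,b]=ab-(-1)^{\deg a\deg b}ba$. The pivot elements are the odd superderivations $v_i=\partial_i+x_ix_{i+1}(\partial_{i+2}+x_{i+2}x_{i+3}(\partial_{i+4}+\cdots))$, $i\ge 0$, that is, $v_i=\partial_i+x_ix_{i+1}v_{i+2}$ (well defined on $\Lambda$, since each element involves finitely many letters). $\mathbf R=\operatorname{Lie}(v_0,v_1)$ is the smallest $\mathbb Z_2$-graded subspace of $\operatorname{End}\Lambda$ containing $v_0,v_1$, closed under the supercommutator and, if $\operatorname{char}K=2$, also under the quadratic mapping $a\mapsto a^2$ on odd elements. An ideal of $\mathbf R$ is a subspace $J$ with $[\mathbf R,J]\subseteq J$; if $\operatorname{char}K=2$, it is also required that $a^2\in J$ for every odd $a\in J$. *)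

theory Defs
  imports Complex_Main
begin

section \<open>The Grassmann algebra on \<open>x\<^sub>0, x\<^sub>1, \<dots>\<close>\<close>

text \<open>
  An element is given by its coefficients in the basis
  \<open>x\<^sub>A = x\<^bsub>a\<^sub>1\<^esub> \<cdots> x\<^bsub>a\<^sub>n\<^esub>\<close>, where \<open>A = {a\<^sub>1 < \<dots> < a\<^sub>n}\<close> is a finite set of
  naturals.
\<close>

typedef (overloaded) ('k::zero) grassmann =
  "{f :: nat set \<Rightarrow> 'k. finite {A. f A \<noteq> 0} \<and> (\<forall>A. f A \<noteq> 0 \<longrightarrow> finite A)}"
  morphisms coef Abs_grassmann
  by (rule exI[of _ "\<lambda>_. 0"]) simp

setup_lifting type_definition_grassmann

lemma finite_supp: "finite {A. coef f A \<noteq> 0}"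
  and coef_infinite: "infinite A \<Longrightarrow> coef f A = 0"
  by (transfer, blast)+

lemma grassmann_eqI: "(\<And>A. finite A \<Longrightarrow> coef f A = coef g A) \<Longrightarrow> f = g"
  by (metis coef_inject coef_infinite ext)

definition inversions :: "nat set \<Rightarrow> nat set \<Rightarrow> nat" where
  "inversions A B = card {(a, b). a \<in> A \<and> b \<in> B \<and> b < a}"

lemma finite_inversions: "finite A \<Longrightarrow> finite B \<Longrightarrow> finite {(a, b). a \<in> A \<and> b \<in> B \<and> b < (a::nat)}"
  by (rule finite_subset[of _ "A \<times> B"]) auto

lemma inversions_Un_left:
  assumes "finite A" "finite B" "finite C" "A \<inter> B = {}"
  shows "inversions (A \<union> B) C = inversions A C + inversions B C"
proof -
  have "{(a, b). a \<in> A \<union> B \<and> b \<in> C \<and> b < a} =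
        {(a, b). a \<in> A \<and> b \<in> C \<and> b < a} \<union> {(a, b). a \<in> B \<and> b \<in> C \<and> b < a}" by auto
  then show ?thesis unfolding inversions_def
    using assms finite_inversions by (simp, subst card_Un_disjoint) auto
qed

lemma inversions_Un_right:
  assumes "finite A" "finite B" "finite C" "B \<inter> C = {}"
  shows "inversions A (B \<union> C) = inversions A B + inversions A C"
proof -
  have "{(a, b). a \<in> A \<and> b \<in> B \<union> C \<and> b < a} =
        {(a, b). a \<in> A \<and> b \<in> B \<and> b < a} \<union> {(a, b). a \<in> A \<and> b \<in> C \<and> b < a}" by auto
  then show ?thesis unfolding inversions_def
    using assms finite_inversions by (simp, subst card_Un_disjoint) auto
qed

lemma inversions_sing_left: "inversions {i} B = card {b \<in> B. b < i}"
proof -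
  have "{(a, b). a \<in> {i} \<and> b \<in> B \<and> b < a} = Pair i ` {b \<in> B. b < i}" by auto
  then show ?thesis unfolding inversions_def by (simp add: card_image inj_on_def)
qed

lemma inversions_sing_right: "inversions A {i} = card {a \<in> A. i < a}"
proof -
  have "{(a, b). a \<in> A \<and> b \<in> {i} \<and> b < a} = (\<lambda>a. (a, i)) ` {a \<in> A. i < a}" by auto
  then show ?thesis unfolding inversions_def by (simp add: card_image inj_on_def)
qed

lemma inversions_insert_left:
  "finite A \<Longrightarrow> finite B \<Longrightarrow> i \<notin> A \<Longrightarrow>
    inversions (insert i A) B = inversions A B + card {b \<in> B. b < i}"
  using inversions_Un_left[of A "{i}" B] by (simp add: inversions_sing_left)

lemma inversions_insert_right:
  "finite A \<Longrightarrow> finite B \<Longrightarrow> i \<notin> B \<Longrightarrow>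
    inversions A (insert i B) = inversions A B + card {a \<in> A. i < a}"
  using inversions_Un_right[of A B "{i}"] by (simp add: inversions_sing_right)

lemma inversions_empty [simp]: "inversions {} B = 0" "inversions A {} = 0"
  by (auto simp: inversions_def)

lemma finite_supp_add:
  "finite {A. f A \<noteq> 0} \<Longrightarrow> finite {A. g A \<noteq> 0} \<Longrightarrow> finite {A. f A + g A \<noteq> (0 :: 'b::monoid_add)}"
  by (rule finite_subset[of _ "{A. f A \<noteq> 0} \<union> {A. g A \<noteq> 0}"]) auto

instantiation grassmann :: (field) ring_1
begin

lift_definition zero_grassmann :: "'a grassmann" is "\<lambda>_. 0" by simp

lift_definition one_grassmann :: "'a grassmann" is "\<lambda>A. if A = {} then 1 else 0" by auto

lift_definition plus_grassmann :: "'a grassmann \<Rightarrow> 'a grassmann \<Rightarrow> 'a grassmann"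
  is "\<lambda>f g A. f A + g A"
  by (simp add: finite_supp_add) (metis add.left_neutral)

lift_definition uminus_grassmann :: "'a grassmann \<Rightarrow> 'a grassmann" is "\<lambda>f A. - f A" by simp

definition minus_grassmann :: "'a grassmann \<Rightarrow> 'a grassmann \<Rightarrow> 'a grassmann" where
  "minus_grassmann f g = f + - g"

text \<open>\<open>x\<^sub>A x\<^sub>B = (-1)^(inversions A B) x\<^bsub>A \<union> B\<^esub>\<close> if \<open>A\<close> and \<open>B\<close> are disjoint,
  and \<open>x\<^sub>A x\<^sub>B = 0\<close> otherwise.\<close>

lift_definition times_grassmann :: "'a grassmann \<Rightarrow> 'a grassmann \<Rightarrow> 'a grassmann"
  is "\<lambda>f g C. \<Sum>A\<in>Pow C. (- 1) ^ inversions A (C - A) * f A * g (C - A)"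
proof -
  fix f g :: "nat set \<Rightarrow> 'a"
  assume f: "finite {A. f A \<noteq> 0} \<and> (\<forall>A. f A \<noteq> 0 \<longrightarrow> finite A)"
    and g: "finite {A. g A \<noteq> 0} \<and> (\<forall>A. g A \<noteq> 0 \<longrightarrow> finite A)"
  let ?h = "\<lambda>C. \<Sum>A\<in>Pow C. (- 1) ^ inversions A (C - A) * f A * g (C - A)"
  have "{C. ?h C \<noteq> 0} \<subseteq> (\<lambda>(A, B). A \<union> B) ` ({A. f A \<noteq> 0} \<times> {A. g A \<noteq> 0})"
  proof
    fix C assume "C \<in> {C. ?h C \<noteq> 0}"
    then have "?h C \<noteq> 0" by simp
    then obtain A where A: "A \<in> Pow C" "(- 1) ^ inversions A (C - A) * f A * g (C - A) \<noteq> 0"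
      by (rule sum.not_neutral_contains_not_neutral)
    then have "f A \<noteq> 0" "g (C - A) \<noteq> 0" "A \<union> (C - A) = C" by auto
    then show "C \<in> (\<lambda>(A, B). A \<union> B) ` ({A. f A \<noteq> 0} \<times> {A. g A \<noteq> 0})"
      by (intro image_eqI[of _ _ "(A, C - A)"]) simp_all
  qed
  moreover have "finite {A. f A \<noteq> 0}" "finite {A. g A \<noteq> 0}" using f g by simp_all
  ultimately have "finite {C. ?h C \<noteq> 0}"
    using finite_subset[OF _ finite_imageI[OF finite_cartesian_product]] by blast
  moreover have "?h C \<noteq> 0 \<longrightarrow> finite C" for C
    by (metis finite_Pow_iff sum.infinite)
  ultimately show "finite {C. ?h C \<noteq> 0} \<and> (\<forall>C. ?h C \<noteq> 0 \<longrightarrow> finite C)" by simp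
qed

lemma grassmann_mult_assoc: "(f * g) * h = f * (g * (h :: 'a grassmann))"
proof (rule grassmann_eqI)
  fix C :: "nat set" assume C: "finite C"
  let ?e = "\<lambda>A B. (- 1 :: 'a) ^ inversions A B"
  have "coef (f * g * h) C = (\<Sum>D\<in>Pow C. \<Sum>A\<in>Pow D.
      ?e D (C - D) * ?e A (D - A) * coef f A * coef g (D - A) * coef h (C - D))"
    by (simp add: times_grassmann.rep_eq sum_distrib_left sum_distrib_right mult_ac)
  also have "\<dots> = (\<Sum>(D, A)\<in>Sigma (Pow C) Pow.
      ?e D (C - D) * ?e A (D - A) * coef f A * coef g (D - A) * coef h (C - D))"
    using C by (subst sum.Sigma) (auto intro: finite_subset)
  also have "\<dots> = (\<Sum>(A, B)\<in>Sigma (Pow C) (\<lambda>A. Pow (C - A)).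
      ?e A (C - A) * ?e B (C - A - B) * coef f A * coef g B * coef h (C - A - B))"
  proof (rule sum.reindex_bij_witness[where i = "\<lambda>(A, B). (A \<union> B, A)" and j = "\<lambda>(D, A). (A, D - A)"],
      goal_cases)
    case (5 p)
    obtain D A where p: "p = (D, A)" by (cases p)
    with 5 have DA: "A \<subseteq> D" "D \<subseteq> C" by auto
    define B E where "B = D - A" and "E = C - D"
    have fin: "finite A" "finite B" "finite E"
      using DA C unfolding B_def E_def by (auto intro: finite_subset)
    have eqs: "D = A \<union> B" "C - A = B \<union> E" "A \<inter> B = {}" "B \<inter> E = {}" "A \<inter> E = {}"
      using DA unfolding B_def E_def by auto
    have "inversions D E + inversions A B = inversions A (C - A) + inversions B E"
      unfolding eqs using fin eqs(3-) by (simp add: inversions_Un_left inversions_Un_right)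
    then have key: "?e D E * ?e A B = ?e A (C - A) * ?e B E"
      by (metis power_add)
    have "D - A = B" "C - D = E" "C - A - B = E" using DA unfolding B_def E_def by auto
    then show ?case by (simp only: p prod.case key)
  qed auto
  also have "\<dots> = (\<Sum>A\<in>Pow C. \<Sum>B\<in>Pow (C - A).
      ?e A (C - A) * ?e B (C - A - B) * coef f A * coef g B * coef h (C - A - B))"
    using C by (subst sum.Sigma) auto
  also have "\<dots> = coef (f * (g * h)) C"
    by (simp add: times_grassmann.rep_eq sum_distrib_left mult_ac)
  finally show "coef (f * g * h) C = coef (f * (g * h)) C" .
qed

lemma grassmann_one_mult: "1 * f = (f :: 'a grassmann)" "f * 1 = (f :: 'a grassmann)"
proof -
  have "coef (1 * f) C = coef f C" if C: "finite C" for C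
  proof -
    have "coef (1 * f) C = (\<Sum>A\<in>Pow C. if A = {} then coef f C else 0)"
      unfolding times_grassmann.rep_eq one_grassmann.rep_eq by (rule sum.cong) auto
    then show ?thesis using C by simp
  qed
  then show "1 * f = f" by (rule grassmann_eqI)
  have "coef (f * 1) C = coef f C" if C: "finite C" for C
  proof -
    have "coef (f * 1) C = (\<Sum>A\<in>Pow C. if A = C then coef f C else 0)"
      unfolding times_grassmann.rep_eq one_grassmann.rep_eq by (rule sum.cong) auto
    then show ?thesis using C by simp
  qed
  then show "f * 1 = f" by (rule grassmann_eqI)
qed

instance
proof
  fix f g h :: "'a grassmann"
  show "f * g * h = f * (g * h)" by (rule grassmann_mult_assoc)
  show "1 * f = f" "f * 1 = f" by (rule grassmann_one_mult)+
  show "(f + g) * h = f * h + g * h" "h * (f + g) = h * f + h * g"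
    by (rule grassmann_eqI, simp add: times_grassmann.rep_eq plus_grassmann.rep_eq
        algebra_simps sum.distrib)+
  show "(0 :: 'a grassmann) \<noteq> 1"
    by (metis one_grassmann.rep_eq zero_grassmann.rep_eq zero_neq_one)
  show "f - g = f + - g" by (rule minus_grassmann_def)
  show "f + g + h = f + (g + h)" "f + g = g + f" "0 + f = f" "- f + f = 0"
    by (rule grassmann_eqI, simp add: plus_grassmann.rep_eq zero_grassmann.rep_eq
        uminus_grassmann.rep_eq add_ac)+
qed

end

lift_definition gscale :: "'k::field \<Rightarrow> 'k grassmann \<Rightarrow> 'k grassmann" is "\<lambda>c f A. c * f A"
proof (rule conjI)
  fix c :: 'k and f :: "nat set \<Rightarrow> 'k"
  assume f: "finite {A. f A \<noteq> 0} \<and> (\<forall>A. f A \<noteq> 0 \<longrightarrow> finite A)"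
  show "finite {A. c * f A \<noteq> 0}"
    by (rule finite_subset[OF _ conjunct1[OF f]]) auto
  show "\<forall>A. c * f A \<noteq> 0 \<longrightarrow> finite A"
    using f by (metis mult_zero_right)
qed

lemma coef_simps [simp]:
  "coef 0 A = 0" "coef 1 A = (if A = {} then 1 else 0)" "coef (f + g) A = coef f A + coef g A"
  "coef (- f) A = - coef f A" "coef (f - g) A = coef f A - coef g A"
  "coef (gscale c f) A = c * coef f A"
  unfolding minus_grassmann_def zero_grassmann.rep_eq one_grassmann.rep_eq
    plus_grassmann.rep_eq uminus_grassmann.rep_eq gscale.rep_eq
  by simp_all

lemma coef_mult:
  "coef (f * g) C = (\<Sum>A\<in>Pow C. (- 1) ^ inversions A (C - A) * coef f A * coef g (C - A))"
  by (simp add: times_grassmann.rep_eq)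

lemma coef_sum [simp]: "coef (\<Sum>i\<in>S. f i) A = (\<Sum>i\<in>S. coef (f i) A)"
  by (induction S rule: infinite_finite_induct) auto

global_interpretation gr: vector_space "gscale :: 'k::field \<Rightarrow> _"
  by unfold_locales (auto intro!: grassmann_eqI simp: algebra_simps)

lemma gscale_mult_left: "gscale c f * g = gscale c (f * g)"
  and gscale_mult_right: "f * gscale c g = gscale c (f * g)"
  by (rule grassmann_eqI, simp add: coef_mult sum_distrib_left mult_ac)+

lift_definition monom :: "nat set \<Rightarrow> 'k::field grassmann"
  is "\<lambda>B A. if finite A \<and> A = B then 1 else 0"
proof -
  fix B :: "nat set"
  have "{A. (if finite A \<and> A = B then 1 else (0::'k)) \<noteq> 0} \<subseteq> {B}" by auto
  then have "finite {A. (if finite A \<and> A = B then 1 else (0::'k)) \<noteq> 0}"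
    by (rule finite_subset) simp
  then show "finite {A. (if finite A \<and> A = B then 1 else (0::'k)) \<noteq> 0} \<and>
      (\<forall>A. (if finite A \<and> A = B then 1 else (0::'k)) \<noteq> 0 \<longrightarrow> finite A)" by simp
qed

definition gx :: "nat \<Rightarrow> 'k::field grassmann" where
  "gx i = monom {i}"

lemma coef_gx: "coef (gx i) A = (if A = {i} then 1 else 0)"
  by (auto simp: gx_def monom.rep_eq)

lemma coef_gx_mult:
  assumes "finite A"
  shows "coef (gx i * f) A =
    (if i \<in> A then (- 1) ^ card {a \<in> A. a < i} * coef f (A - {i}) else 0)"
proof -
  have "coef (gx i * f) A =
      (\<Sum>B\<in>Pow A. if B = {i} then (- 1) ^ inversions {i} (A - {i}) * coef f (A - {i}) else 0)"
    unfolding coef_mult by (rule sum.cong) (auto simp: coef_gx)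
  moreover have "{b \<in> A - {i}. b < i} = {b \<in> A. b < i}" by auto
  ultimately show ?thesis using assms
    by (simp add: inversions_sing_left)
qed

lemma monom_empty: "monom {} = 1"
  by (rule grassmann_eqI) (simp add: monom.rep_eq)

lemma monom_insert:
  assumes "finite A" "\<And>a. a \<in> A \<Longrightarrow> i < a"
  shows "monom (insert i A) = gx i * (monom A :: 'k::field grassmann)"
proof (rule grassmann_eqI)
  fix B :: "nat set" assume B: "finite B"
  have "i \<notin> A" using assms by blast
  show "coef (monom (insert i A)) B = coef (gx i * (monom A :: 'k grassmann)) B"
  proof (cases "B = insert i A")
    case True
    have "{a. a \<in> insert i A \<and> a < i} = {}" using assms(2) by force
    then show ?thesis using True B \<open>i \<notin> A\<close>
      by (simp add: coef_gx_mult monom.rep_eq del: insert_iff Collect_empty_eq)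
        (simp add: insert_Diff_if)
  next
    case False
    then show ?thesis using B \<open>i \<notin> A\<close> by (auto simp: coef_gx_mult monom.rep_eq)
  qed
qed

lemma gx_square: "gx i * gx i = 0"
  by (rule grassmann_eqI) (auto simp: coef_gx_mult coef_gx)

lemma gx_anticommute: "gx i * gx j = - (gx j * (gx i :: 'k::field grassmann))"
proof (cases "i = j")
  case False
  show ?thesis
  proof (rule grassmann_eqI)
    fix A :: "nat set" assume A: "finite A"
    show "coef (gx i * gx j) A = coef (- (gx j * (gx i :: 'k grassmann))) A"
    proof (cases "A = {i, j}")
      case True
      have *: "{a. (a = i \<or> a = j) \<and> a < i} = (if j < i then {j} else {})"
        "{a. (a = i \<or> a = j) \<and> a < j} = (if i < j then {i} else {})" by auto
      have "{i, j} - {i} = {j}" "{i, j} - {j} = {i}" using False by auto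
      then show ?thesis using True False
        by (simp add: coef_gx_mult coef_gx *)
    next
      case 2: False
      then have "\<not> (i \<in> A \<and> A - {i} = {j})" "\<not> (j \<in> A \<and> A - {j} = {i})" by auto
      then show ?thesis using A by (auto simp: coef_gx_mult coef_gx)
    qed
  qed
qed (simp add: gx_square)

text \<open>Only the parity of \<open>p\<close> matters, here and in all later notions of degree.\<close>

definition ghom :: "nat \<Rightarrow> 'k::field grassmann \<Rightarrow> bool" where
  "ghom p f \<longleftrightarrow> (\<forall>A. coef f A \<noteq> 0 \<longrightarrow> even (card A) = even p)"

lift_definition gcomp :: "nat \<Rightarrow> 'k::field grassmann \<Rightarrow> 'k grassmann"
  is "\<lambda>p f A. if even (card A) = even p then f A else 0"
proof (rule conjI)
  fix p :: nat and f :: "nat set \<Rightarrow> 'k"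
  assume f: "finite {A. f A \<noteq> 0} \<and> (\<forall>A. f A \<noteq> 0 \<longrightarrow> finite A)"
  show "finite {A. (if even (card A) = even p then f A else 0) \<noteq> 0}"
    by (rule finite_subset[OF _ conjunct1[OF f]]) auto
  show "\<forall>A. (if even (card A) = even p then f A else 0) \<noteq> 0 \<longrightarrow> finite A"
    using f by metis
qed

section \<open>The associative superalgebra of endomorphisms\<close>

lemma linear_gscale_iff:
  "Vector_Spaces.linear gscale gscale D \<longleftrightarrow>
    (\<forall>f g. D (f + g) = D f + D g) \<and> (\<forall>c f. D (gscale c f) = gscale c (D f))"
  by (simp add: Vector_Spaces.linear_iff gr.vector_space_axioms)

lemma linear_gscaleI:
  "(\<And>f g. D (f + g) = D f + D g) \<Longrightarrow> (\<And>c f. D (gscale c f) = gscale c (D f)) \<Longrightarrow>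
    Vector_Spaces.linear gscale gscale D"
  by (simp add: linear_gscale_iff)

typedef (overloaded) ('k::field) grend =
  "{D :: 'k grassmann \<Rightarrow> 'k grassmann. Vector_Spaces.linear gscale gscale D}"
  morphisms app Abs_grend
  by (rule exI[of _ "\<lambda>_. 0"]) (simp add: linear_gscale_iff)

lifting_forget grassmann.lifting
setup_lifting type_definition_grend

lemma linear_app: "Vector_Spaces.linear gscale gscale (app D)"
  using app[of D] by simp

lemma app_add: "app D (f + g) = app D f + app D g"
  and app_gscale: "app D (gscale c f) = gscale c (app D f)"
  using linear_app[of D] by (simp_all add: linear_gscale_iff)

lemma app_zero: "app D 0 = 0"
  using app_add[of D 0 0] by simp

lemma app_sum: "app D (\<Sum>i\<in>S. h i) = (\<Sum>i\<in>S. app D (h i))"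
  by (induction S rule: infinite_finite_induct) (simp_all add: app_zero app_add)

lemma grend_eqI: "(\<And>f. app D f = app E f) \<Longrightarrow> D = E"
  by (metis app_inject ext)

instantiation grend :: (field) ring_1
begin

lift_definition zero_grend :: "'a grend" is "\<lambda>_. 0" by (simp add: linear_gscale_iff)
lift_definition one_grend :: "'a grend" is "\<lambda>f. f" by (simp add: linear_gscale_iff)
lift_definition plus_grend :: "'a grend \<Rightarrow> 'a grend \<Rightarrow> 'a grend" is "\<lambda>D E f. D f + E f"
  by (simp add: linear_gscale_iff gr.scale_right_distrib gr.scale_right_diff_distrib)
lift_definition minus_grend :: "'a grend \<Rightarrow> 'a grend \<Rightarrow> 'a grend" is "\<lambda>D E f. D f - E f"
  by (simp add: linear_gscale_iff gr.scale_right_distrib gr.scale_right_diff_distrib)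
lift_definition uminus_grend :: "'a grend \<Rightarrow> 'a grend" is "\<lambda>D f. - D f"
  by (simp add: linear_gscale_iff gr.scale_right_distrib gr.scale_right_diff_distrib)
lift_definition times_grend :: "'a grend \<Rightarrow> 'a grend \<Rightarrow> 'a grend" is "\<lambda>D E f. D (E f)"
  by (simp add: linear_gscale_iff)

instance
proof
  have "app 0 (1 :: 'a grassmann) \<noteq> app 1 1"
    by (simp add: zero_grend.rep_eq one_grend.rep_eq)
  then show "(0 :: 'a grend) \<noteq> 1" by metis
qed (rule grend_eqI, simp add: plus_grend.rep_eq minus_grend.rep_eq uminus_grend.rep_eq
      times_grend.rep_eq zero_grend.rep_eq one_grend.rep_eq app_add algebra_simps)+

end

lemmas app_simps [simp] = zero_grend.rep_eq one_grend.rep_eq plus_grend.rep_eq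
  minus_grend.rep_eq uminus_grend.rep_eq times_grend.rep_eq

lift_definition escale :: "'k::field \<Rightarrow> 'k grend \<Rightarrow> 'k grend" is "\<lambda>c D f. gscale c (D f)"
  by (simp add: linear_gscale_iff gr.scale_right_distrib mult.commute)

global_interpretation gend: vector_space "escale :: 'k::field \<Rightarrow> _"
  by unfold_locales (auto intro!: grend_eqI simp: escale.rep_eq
      gr.scale_right_distrib gr.scale_left_distrib)

lift_definition lmult :: "'k::field grassmann \<Rightarrow> 'k grend" is "\<lambda>f g. f * g"
  by (simp add: linear_gscale_iff distrib_left gscale_mult_right)

definition ehom :: "nat \<Rightarrow> 'k::field grend \<Rightarrow> bool" where
  "ehom p D \<longleftrightarrow> (\<forall>q f. ghom q f \<longrightarrow> ghom (p + q) (app D f))"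

lemma coef_gcomp: "coef (gcomp p f) A = (if even (card A) = even p then coef f A else 0)"
  by (simp add: gcomp.rep_eq)

lemma ghom_gcomp: "ghom p (gcomp p f)"
  by (simp add: ghom_def coef_gcomp)

lemma ghom_cong: "even p = even q \<Longrightarrow> ghom p f = ghom q f"
  by (simp add: ghom_def)

lemma gcomp_cong: "even p = even q \<Longrightarrow> gcomp p f = gcomp q f"
  by (rule grassmann_eqI) (simp add: coef_gcomp)

lemma gcomp_ghom:
  "ghom p f \<Longrightarrow> gcomp q f = (if even p = even q then f else 0)"
  by (rule grassmann_eqI) (auto simp: coef_gcomp ghom_def)

lemma gcomp_sum: "gcomp 0 f + gcomp 1 f = f"
  by (rule grassmann_eqI) (simp add: coef_gcomp)

lemma linear_gcomp: "Vector_Spaces.linear gscale gscale (gcomp p)"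
  by (rule linear_gscaleI; rule grassmann_eqI; simp add: coef_gcomp)

lemma gcomp_add: "gcomp p (f + g) = gcomp p f + gcomp p g"
  and gcomp_zero [simp]: "gcomp p 0 = 0"
  by (rule grassmann_eqI, simp add: coef_gcomp)+

definition gproj :: "nat \<Rightarrow> 'k::field grend" where
  "gproj p = Abs_grend (gcomp p)"

lemma app_gproj: "app (gproj p) f = gcomp p f"
  by (simp add: gproj_def Abs_grend_inverse linear_gcomp)

text \<open>The homogeneous component of degree \<open>p\<close> of an endomorphism.\<close>

definition ecomp :: "nat \<Rightarrow> 'k::field grend \<Rightarrow> 'k grend" where
  "ecomp p D = (\<Sum>q<2. gproj (p + q) * D * gproj q)"

lemma app_ecomp: "app (ecomp p D) f = gcomp p (app D (gcomp 0 f)) + gcomp (p + 1) (app D (gcomp 1 f))"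
  by (simp add: ecomp_def numeral_2_eq_2 app_gproj)

lemma ehom_ecomp: "ehom p (ecomp p D)"
  unfolding ehom_def
proof (intro allI impI)
  fix q f assume "ghom q (f :: 'a grassmann)"
  then show "ghom (p + q) (app (ecomp p D) f)"
    by (cases "even q"; simp add: app_ecomp gcomp_ghom app_zero)
      (auto simp: ghom_def coef_gcomp)
qed

lemma app_gcomp_sum: "app D (gcomp 0 f) + app D (gcomp 1 f) = app D f"
  by (metis app_add gcomp_sum)

lemma ecomp_sum: "ecomp 0 D + ecomp 1 D = D"
proof (rule grend_eqI)
  fix f
  let ?h = "\<lambda>i. app D (gcomp i f)"
  have "app (ecomp 0 D + ecomp 1 D) f = (gcomp 0 (?h 0) + gcomp 1 (?h 0)) + (gcomp 0 (?h 1) + gcomp 1 (?h 1))"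
    using gcomp_cong[of 2 0 "?h 1"] by (simp add: app_ecomp numeral_2_eq_2)
  also have "\<dots> = app D f" by (simp only: gcomp_sum app_gcomp_sum)
  finally show "app (ecomp 0 D + ecomp 1 D) f = app D f" .
qed

lemma ecomp_ehom:
  assumes "ehom p D"
  shows "ecomp q D = (if even p = even q then D else 0)"
proof (rule grend_eqI)
  fix f
  have 0: "ghom p (app D (gcomp 0 f))" and 1: "ghom (p + 1) (app D (gcomp 1 f))"
    using assms[unfolded ehom_def, rule_format, OF ghom_gcomp[of 0 f]]
      assms[unfolded ehom_def, rule_format, OF ghom_gcomp[of 1 f]] by simp_all
  show "app (ecomp q D) f = app (if even p = even q then D else 0) f"
    using app_gcomp_sum[of D f] by (auto simp: app_ecomp gcomp_ghom[OF 0] gcomp_ghom[OF 1[simplified]])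
qed

text \<open>The bilinear extension of \<open>[D, E] = D E - (-1)^(p q) E D\<close>, for \<open>D\<close>, \<open>E\<close> of
  degrees \<open>p\<close>, \<open>q\<close>.\<close>

definition sbracket :: "'k::field grend \<Rightarrow> 'k grend \<Rightarrow> 'k grend" where
  "sbracket D E = (\<Sum>p<2. \<Sum>q<2.
     ecomp p D * ecomp q E - (- 1) ^ (p * q) * (ecomp q E * ecomp p D))"

lemma sbracket_ehom:
  assumes "ehom p D" "ehom q E"
  shows "sbracket D E = D * E - (- 1) ^ (p * q) * (E * D)"
proof -
  have "sbracket D E = (\<Sum>p\<in>{0, 1}. \<Sum>q\<in>{0, 1}.
      ecomp p D * ecomp q E - (- 1) ^ (p * q) * (ecomp q E * ecomp p D))"
    unfolding sbracket_def by (intro sum.cong) auto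
  then show ?thesis
    by (cases "even p"; cases "even q";
        simp add: ecomp_ehom[OF assms(1)] ecomp_ehom[OF assms(2)] minus_one_power_iff)
qed

section \<open>The superderivations \<open>\<partial>\<^sub>i\<close> and the pivot elements\<close>

definition odd_superderivation :: "'k::field grend \<Rightarrow> bool" where
  "odd_superderivation D \<longleftrightarrow> ehom 1 D \<and>
     (\<forall>p f g. ghom p f \<longrightarrow> app D (f * g) = app D f * g + (- 1) ^ p * (f * app D g))"

definition gderiv_raw :: "nat \<Rightarrow> 'k::field grassmann \<Rightarrow> 'k grassmann" where
  "gderiv_raw i f = Abs_grassmann
     (\<lambda>A. if i \<in> A then 0 else (- 1) ^ card {a \<in> A. a < i} * coef f (insert i A))"

lemma coef_gderiv_raw:
  "coef (gderiv_raw i f) A =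
    (if i \<in> A then 0 else (- 1) ^ card {a \<in> A. a < i} * coef f (insert i A))"
proof -
  let ?h = "\<lambda>A. if i \<in> A then 0 else (- 1) ^ card {a \<in> A. a < i} * coef f (insert i A)"
  have "{A. ?h A \<noteq> 0} \<subseteq> (\<lambda>B. B - {i}) ` {B. coef f B \<noteq> 0}"
  proof
    fix A assume "A \<in> {A. ?h A \<noteq> 0}"
    then have "i \<notin> A" "coef f (insert i A) \<noteq> 0" by (auto split: if_splits)
    then show "A \<in> (\<lambda>B. B - {i}) ` {B. coef f B \<noteq> 0}"
      by (intro image_eqI[of _ _ "insert i A"]) auto
  qed
  then have "finite {A. ?h A \<noteq> 0}" by (rule finite_subset) (rule finite_imageI[OF finite_supp])
  moreover have "\<forall>A. ?h A \<noteq> 0 \<longrightarrow> finite A"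
  proof (intro allI impI, rule ccontr)
    fix A assume "?h A \<noteq> 0" "infinite A"
    then show False using coef_infinite[of "insert i A" f] by (simp split: if_splits)
  qed
  ultimately have "?h \<in> {f. finite {A. f A \<noteq> 0} \<and> (\<forall>A. f A \<noteq> 0 \<longrightarrow> finite A)}"
    by (intro CollectI conjI)
  then show ?thesis
    unfolding gderiv_raw_def by (simp only: Abs_grassmann_inverse)
qed

definition gderiv :: "nat \<Rightarrow> 'k::field grend" where
  "gderiv i = Abs_grend (gderiv_raw i)"

lemma app_gderiv: "app (gderiv i) f = gderiv_raw i f"
  unfolding gderiv_def
  by (subst Abs_grend_inverse)
    (auto intro!: linear_gscaleI grassmann_eqI simp: coef_gderiv_raw algebra_simps)

lemma coef_gderiv:
  "coef (app (gderiv i) f) A =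
    (if i \<in> A then 0 else (- 1) ^ card {a \<in> A. a < i} * coef f (insert i A))"
  by (simp add: app_gderiv coef_gderiv_raw)

lemma gderiv_gx: "app (gderiv i) (gx j) = (if i = j then 1 else 0)"
  by (rule grassmann_eqI) (auto simp: coef_gderiv coef_gx)

lemma minus_one_power_mult: "(- 1) ^ p * (f :: 'k::field grassmann) = gscale ((- 1) ^ p) f"
  by (cases "even p") simp_all

lemma sum_Pow_insert:
  assumes "finite C" "i \<notin> C"
  shows "(\<Sum>A\<in>Pow (insert i C). h A) = (\<Sum>A\<in>Pow C. h A + h (insert i A) :: 'b::comm_monoid_add)"
proof -
  have inj: "inj_on (insert i) (Pow C)"
    using assms by (intro inj_onI) (metis Pow_iff insert_ident subsetD)
  have "(\<Sum>A\<in>Pow (insert i C). h A) = (\<Sum>A\<in>Pow C. h A) + (\<Sum>A\<in>insert i ` Pow C. h A)"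
    unfolding Pow_insert using assms by (intro sum.union_disjoint) auto
  also have "(\<Sum>A\<in>insert i ` Pow C. h A) = (\<Sum>A\<in>Pow C. h (insert i A))"
    using inj by (simp add: sum.reindex)
  finally show ?thesis by (simp add: sum.distrib)
qed

lemma card_less_greater:
  assumes "finite A" "(i::nat) \<notin> A"
  shows "card {a \<in> A. a < i} + card {a \<in> A. i < a} = card A"
proof -
  have "A = {a \<in> A. a < i} \<union> {a \<in> A. i < a}" using assms nat_neq_iff by auto
  then show ?thesis using assms
    by (metis (no_types, lifting) card_Un_disjoint finite_Un mem_Collect_eq disjoint_iff order_less_asym)
qed

lemma card_less_Un:
  assumes "finite C" "A \<subseteq> C"
  shows "card {a \<in> C. a < i} = card {a \<in> A. a < i} + card {a \<in> C - A. a < (i::nat)}"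
proof -
  have "{a \<in> C. a < i} = {a \<in> A. a < i} \<union> {a \<in> C - A. a < i}" using assms by auto
  moreover have "card ({a \<in> A. a < i} \<union> {a \<in> C - A. a < i}) =
      card {a \<in> A. a < i} + card {a \<in> C - A. a < (i::nat)}"
    using assms by (intro card_Un_disjoint) (auto intro: finite_subset)
  ultimately show ?thesis by simp
qed

lemma minus_one_power_cong: "even m = even n \<Longrightarrow> (- 1 :: 'a::ring_1) ^ m = (- 1) ^ n"
  by (cases "even m") auto

lemma gderiv_mult:
  fixes f g :: "'k::field grassmann"
  assumes f: "ghom p f"
  shows "app (gderiv i) (f * g) = app (gderiv i) f * g + (- 1) ^ p * (f * app (gderiv i) g)"
proof (rule grassmann_eqI)
  fix C :: "nat set" assume C: "finite C"
  let ?s = "\<lambda>n. (- 1 :: 'k) ^ n" and ?l = "\<lambda>A. card {a \<in> A. a < i}"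
  have fp: "?s p * coef f A = ?s (card A) * coef f A" for A
    using f unfolding ghom_def by (cases "coef f A = 0") (auto intro: minus_one_power_cong)
  have fpt: "?s p * (?s n * coef f A * h) = ?s (n + card A) * coef f A * h" for n A h
  proof -
    have "?s p * (?s n * coef f A * h) = ?s n * (?s p * coef f A) * h" by (simp only: mult_ac)
    also have "\<dots> = ?s (n + card A) * coef f A * h" unfolding fp by (simp only: power_add mult_ac)
    finally show ?thesis .
  qed
  have rhs: "coef (app (gderiv i) f * g + (- 1) ^ p * (f * app (gderiv i) g)) C =
     (\<Sum>A\<in>Pow C. ?s (inversions A (C - A)) * coef (app (gderiv i) f) A * coef g (C - A)
       + ?s (inversions A (C - A) + card A) * coef f A * coef (app (gderiv i) g) (C - A))"
    (is "_ = (\<Sum>A\<in>Pow C. ?R A)")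
    unfolding minus_one_power_mult coef_simps coef_mult sum_distrib_left sum.distrib fpt
    by (rule refl)
  show "coef (app (gderiv i) (f * g)) C =
      coef (app (gderiv i) f * g + (- 1) ^ p * (f * app (gderiv i) g)) C"
  proof (cases "i \<in> C")
    case False
    have "coef (app (gderiv i) (f * g)) C = (\<Sum>A\<in>Pow C. ?s (?l C) *
        (?s (inversions A (insert i C - A)) * coef f A * coef g (insert i C - A) +
         ?s (inversions (insert i A) (insert i C - insert i A)) * coef f (insert i A) *
           coef g (insert i C - insert i A)))"
      using False C by (simp add: coef_gderiv coef_mult sum_Pow_insert sum_distrib_left)
    also have "\<dots> = (\<Sum>A\<in>Pow C. ?R A)"
    proof (rule sum.cong[OF refl])
      fix A assume A: "A \<in> Pow C"
      define B where "B = C - A"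
      have fin: "finite A" "finite B" and i: "i \<notin> A" "i \<notin> B" "i \<notin> C"
        using A C False unfolding B_def by (auto intro: finite_subset)
      have eqs: "insert i C - A = insert i B" "insert i C - insert i A = B"
        using i unfolding B_def by auto
      have l: "?l C = ?l A + ?l B" using card_less_Un[of C A i] A C unfolding B_def by auto
      have s1: "?s (?l C) * ?s (inversions A (insert i B)) = ?s (inversions A B + card A) * ?s (?l B)"
        unfolding power_add[symmetric] using card_less_greater[OF fin(1) i(1), symmetric] fin i
        by (intro minus_one_power_cong) (simp add: inversions_insert_right l, presburger)
      have s2: "?s (?l C) * ?s (inversions (insert i A) B) = ?s (inversions A B) * ?s (?l A)"
        unfolding power_add[symmetric] using fin i
        by (intro minus_one_power_cong) (simp add: inversions_insert_left l, presburger)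
      have "?s (?l C) * (?s (inversions A (insert i B)) * coef f A * coef g (insert i B) +
          ?s (inversions (insert i A) B) * coef f (insert i A) * coef g B) =
        (?s (?l C) * ?s (inversions A (insert i B))) * coef f A * coef g (insert i B) +
        (?s (?l C) * ?s (inversions (insert i A) B)) * coef f (insert i A) * coef g B"
        by (simp add: algebra_simps)
      also have "\<dots> = ?s (inversions A B) * coef (app (gderiv i) f) A * coef g B
         + ?s (inversions A B + card A) * coef f A * coef (app (gderiv i) g) B"
        unfolding s1 s2 using i by (simp add: coef_gderiv)
      finally show "?s (?l C) *
        (?s (inversions A (insert i C - A)) * coef f A * coef g (insert i C - A) +
         ?s (inversions (insert i A) (insert i C - insert i A)) * coef f (insert i A) *
           coef g (insert i C - insert i A)) = ?R A"
        unfolding eqs B_def[symmetric] .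
    qed
    finally show ?thesis unfolding rhs .
  next
    case True
    define D where "D = C - {i}"
    have D: "finite D" "i \<notin> D" "C = insert i D" using C True unfolding D_def by auto
    have "(\<Sum>A\<in>Pow C. ?R A) = (\<Sum>A\<in>Pow D. ?R A + ?R (insert i A))"
      unfolding D(3) by (rule sum_Pow_insert[OF D(1,2)])
    also have "\<dots> = 0"
    proof (rule sum.neutral, rule ballI)
      fix A assume A: "A \<in> Pow D"
      define B where "B = D - A"
      have fin: "finite A" "finite B" and i: "i \<notin> A" "i \<notin> B"
        using A D unfolding B_def by (auto intro: finite_subset)
      have eqs: "C - A = insert i B" "C - insert i A = B" using D i unfolding B_def by auto
      have s1: "?s (inversions A (insert i B)) * ?s (?l A) = ?s (inversions A B + card A)"
        unfolding power_add[symmetric] using card_less_greater[OF fin(1) i(1), symmetric] fin i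
        by (intro minus_one_power_cong) (simp add: inversions_insert_right, argo)
      have s2: "?s (inversions (insert i A) B + card (insert i A)) * ?s (?l B) =
          - ?s (inversions A B + card A)"
      proof -
        have "?s (inversions (insert i A) B + card (insert i A)) * ?s (?l B) =
            ?s (Suc (inversions A B + card A))"
          unfolding power_add[symmetric] using fin i
          by (intro minus_one_power_cong) (simp add: inversions_insert_left, presburger)
        then show ?thesis by simp
      qed
      have "?R A + ?R (insert i A) =
        (?s (inversions A (insert i B)) * ?s (?l A)) * coef f (insert i A) * coef g (insert i B) +
        (?s (inversions (insert i A) B + card (insert i A)) * ?s (?l B)) *
          coef f (insert i A) * coef g (insert i B)"
        unfolding eqs using i by (simp add: coef_gderiv)
      also have "\<dots> = 0" unfolding s1 s2 by simp
      finally show "?R A + ?R (insert i A) = 0" .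
    qed
    finally show ?thesis unfolding rhs using True by (simp add: coef_gderiv)
  qed
qed

lemma odd_superderivation_gderiv: "odd_superderivation (gderiv i :: 'a::field grend)"
proof -
  have "ehom 1 (gderiv i :: 'a grend)"
    unfolding ehom_def ghom_def
  proof (intro allI impI)
    fix q A and f :: "'a grassmann"
    assume f: "\<forall>A. coef f A \<noteq> 0 \<longrightarrow> even (card A) = even q" and A: "coef (app (gderiv i) f) A \<noteq> 0"
    then have "i \<notin> A" "coef f (insert i A) \<noteq> 0" by (auto simp: coef_gderiv split: if_splits)
    moreover from this have "finite A" using coef_infinite[of "insert i A" f] by auto
    ultimately show "even (card A) = even (1 + q)" using f[rule_format, of "insert i A"] by auto
  qed
  then show ?thesis by (simp add: odd_superderivation_def gderiv_mult)
qed

lemma grassmann_expand: "f = (\<Sum>A | coef f A \<noteq> 0. gscale (coef f A) (monom A))"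
proof (rule grassmann_eqI)
  fix B :: "nat set" assume "finite B"
  then have "(\<Sum>A | coef f A \<noteq> 0. coef (gscale (coef f A) (monom A)) B) =
      (\<Sum>A | coef f A \<noteq> 0. if A = B then coef f B else 0)"
    by (intro sum.cong) (auto simp: monom.rep_eq)
  then show "coef f B = coef (\<Sum>A | coef f A \<noteq> 0. gscale (coef f A) (monom A)) B"
    using finite_supp[of f] by simp
qed

lemma superderivation_eqI:
  fixes D E :: "'a::field grend"
  assumes D: "odd_superderivation D" and E: "odd_superderivation E"
    and gx: "\<And>j. app D (gx j) = app E (gx j)"
  shows "D = E"
proof (rule grend_eqI)
  have h1: "ghom 0 (1 :: 'a grassmann)" and hx: "ghom 1 (gx j :: 'a grassmann)" for j
    by (simp_all add: ghom_def coef_gx)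
  have one: "app F 1 = 0" if "odd_superderivation F" for F :: "'a grend"
  proof -
    have "app F (1 * 1) = app F 1 * 1 + (- 1) ^ 0 * (1 * app F 1)"
      using that h1 unfolding odd_superderivation_def by blast
    then show ?thesis by simp
  qed
  have mon: "app D (monom A) = app E (monom A)" if "finite A" for A
    using that
  proof (induction "card A" arbitrary: A)
    case 0
    then show ?case by (simp add: monom_empty one D E)
  next
    case (Suc n)
    then have "A \<noteq> {}" by auto
    define i where "i = Min A"
    define B where "B = A - {i}"
    have i: "i \<in> A" using Suc.prems \<open>A \<noteq> {}\<close> unfolding i_def by simp
    have A: "A = insert i B" "finite B" "card B = n"
      using i Suc unfolding B_def by auto
    have "i < a" if "a \<in> B" for a
      using that Suc.prems unfolding B_def i_def by (metis DiffE Min_le insertI1 order_le_less)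
    then have m: "monom A = gx i * (monom B :: 'a grassmann)"
      unfolding A(1) using A(2) by (intro monom_insert)
    have "app F (monom A) = app F (gx i) * monom B + (- 1) ^ 1 * (gx i * app F (monom B))"
      if "odd_superderivation F" for F :: "'a grend"
      unfolding m using that hx unfolding odd_superderivation_def by blast
    then show ?case using D E gx Suc.hyps(1)[of B] A by simp
  qed
  fix f
  have exp: "app F f = (\<Sum>A | coef f A \<noteq> 0. gscale (coef f A) (app F (monom A)))" for F :: "'a grend"
    using arg_cong[OF grassmann_expand[of f], of "app F"] by (simp only: app_sum app_gscale)
  have "finite A" if "coef f A \<noteq> 0" for A
    using that coef_infinite[of A f] by auto
  then show "app D f = app E f"
    unfolding exp[of D] exp[of E] using mon by (intro sum.cong) auto
qed

theorem gderiv_unique: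
  "odd_superderivation D \<and> (\<forall>j. app D (gx j) = (if i = j then 1 else 0)) \<longleftrightarrow> D = gderiv i"
  using superderivation_eqI[of D "gderiv i"] odd_superderivation_gderiv gderiv_gx by metis

fun pivot_coeff :: "nat \<Rightarrow> nat \<Rightarrow> 'k::field grassmann" where
  "pivot_coeff i 0 = 1"
| "pivot_coeff i (Suc k) = gx i * gx (i + 1) * pivot_coeff (i + 2) k"

text \<open>
  \<open>v\<^sub>i = \<Sum>\<^sub>k x\<^sub>i x\<^bsub>i+1\<^esub> \<cdots> x\<^bsub>i+2k-1\<^esub> \<partial>\<^bsub>i+2k\<^esub>\<close>; only finitely many terms are
  nonzero on a given element.
\<close>

definition pivot_raw :: "nat \<Rightarrow> 'k::field grassmann \<Rightarrow> 'k grassmann" where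
  "pivot_raw i f = (\<Sum>k | app (gderiv (i + 2 * k)) f \<noteq> 0.
     pivot_coeff i k * app (gderiv (i + 2 * k)) f)"

lemma finite_gderiv_nonzero: "finite {j. app (gderiv j) f \<noteq> 0}"
proof (rule finite_subset)
  show "{j. app (gderiv j) f \<noteq> 0} \<subseteq> \<Union> {A. coef f A \<noteq> 0}"
  proof
    fix j assume "j \<in> {j. app (gderiv j) f \<noteq> 0}"
    then obtain A where "coef (app (gderiv j) f) A \<noteq> 0"
      by (metis (mono_tags) coef_simps(1) grassmann_eqI mem_Collect_eq)
    then have "coef f (insert j A) \<noteq> 0" by (auto simp: coef_gderiv split: if_splits)
    then show "j \<in> \<Union> {A. coef f A \<noteq> 0}" by blast
  qed
  show "finite (\<Union> {A. coef f A \<noteq> 0})"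
    using finite_supp[of f] coef_infinite[of _ f] by auto
qed

lemma pivot_raw_bound:
  obtains N where "\<And>n. N \<le> n \<Longrightarrow>
    pivot_raw i f = (\<Sum>k<n. pivot_coeff i k * app (gderiv (i + 2 * k)) f)"
proof -
  obtain N where N: "\<And>j. app (gderiv j) f \<noteq> 0 \<Longrightarrow> j < N"
    using finite_gderiv_nonzero[of f] unfolding finite_nat_set_iff_bounded by auto
  show ?thesis
  proof (rule that[of N])
    fix n assume "N \<le> n"
    then have "{k. app (gderiv (i + 2 * k)) f \<noteq> 0} \<subseteq> {..<n}" using N by fastforce
    then show "pivot_raw i f = (\<Sum>k<n. pivot_coeff i k * app (gderiv (i + 2 * k)) f)"
      unfolding pivot_raw_def by (intro sum.mono_neutral_left) auto
  qed
qed

definition pivot :: "nat \<Rightarrow> 'k::field grend" where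
  "pivot i = Abs_grend (pivot_raw i)"

lemma app_pivot: "app (pivot i) f = pivot_raw i f"
proof -
  have "Vector_Spaces.linear gscale gscale (pivot_raw i :: 'a grassmann \<Rightarrow> _)"
  proof (rule linear_gscaleI)
    fix f g :: "'a grassmann"
    obtain N1 where 1: "\<And>n. N1 \<le> n \<Longrightarrow> pivot_raw i f = (\<Sum>k<n. pivot_coeff i k * app (gderiv (i + 2 * k)) f)"
      using pivot_raw_bound[of i f] by auto
    obtain N2 where 2: "\<And>n. N2 \<le> n \<Longrightarrow> pivot_raw i g = (\<Sum>k<n. pivot_coeff i k * app (gderiv (i + 2 * k)) g)"
      using pivot_raw_bound[of i g] by auto
    obtain N3 where 3: "\<And>n. N3 \<le> n \<Longrightarrow> pivot_raw i (f + g) = (\<Sum>k<n. pivot_coeff i k * app (gderiv (i + 2 * k)) (f + g))"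
      using pivot_raw_bound[of i "f + g"] by auto
    define n where "n = max N1 (max N2 N3)"
    show "pivot_raw i (f + g) = pivot_raw i f + pivot_raw i g"
      using 1[of n] 2[of n] 3[of n] unfolding n_def
      by (simp add: app_add distrib_left sum.distrib)
  next
    fix c and f :: "'a grassmann"
    obtain N1 where 1: "\<And>n. N1 \<le> n \<Longrightarrow> pivot_raw i f = (\<Sum>k<n. pivot_coeff i k * app (gderiv (i + 2 * k)) f)"
      using pivot_raw_bound[of i f] by auto
    obtain N3 where 3: "\<And>n. N3 \<le> n \<Longrightarrow> pivot_raw i (gscale c f) = (\<Sum>k<n. pivot_coeff i k * app (gderiv (i + 2 * k)) (gscale c f))"
      using pivot_raw_bound[of i "gscale c f"] by auto
    define n where "n = max N1 N3"
    show "pivot_raw i (gscale c f) = gscale c (pivot_raw i f)"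
      using 1[of n] 3[of n] unfolding n_def
      by (simp add: app_gscale gscale_mult_right gr.scale_sum_right)
  qed
  then show ?thesis unfolding pivot_def by (simp add: Abs_grend_inverse)
qed

lemma app_lmult [simp]: "app (lmult f) g = f * g"
  by (simp add: lmult_def Abs_grend_inverse linear_gscaleI distrib_left gscale_mult_right)

theorem pivot_rec:
  "pivot i = gderiv i + lmult (gx i) * lmult (gx (i + 1)) * pivot (i + 2)"
proof (rule grend_eqI)
  fix f :: "'a grassmann"
  obtain N1 where 1: "\<And>n. N1 \<le> n \<Longrightarrow> pivot_raw i f = (\<Sum>k<n. pivot_coeff i k * app (gderiv (i + 2 * k)) f)"
    using pivot_raw_bound[of i f] by auto
  obtain N2 where 2: "\<And>n. N2 \<le> n \<Longrightarrow>
      pivot_raw (i + 2) f = (\<Sum>k<n. pivot_coeff (i + 2) k * app (gderiv (i + 2 + 2 * k)) f)"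
    using pivot_raw_bound[of "i + 2" f] by auto
  define n where "n = max N1 N2"
  have "pivot_raw i f = (\<Sum>k<Suc n. pivot_coeff i k * app (gderiv (i + 2 * k)) f)"
    by (rule 1) (simp add: n_def)
  also have "\<dots> = app (gderiv i) f + gx i * gx (i + 1) *
      (\<Sum>k<n. pivot_coeff (i + 2) k * app (gderiv (i + 2 + 2 * k)) f)"
    by (subst sum.lessThan_Suc_shift) (simp add: sum_distrib_left mult.assoc add_ac)
  also have "\<dots> = app (gderiv i) f + gx i * gx (i + 1) * pivot_raw (i + 2) f"
    using 2[of n] unfolding n_def by simp
  finally show "app (pivot i) f =
      app (gderiv i + lmult (gx i) * lmult (gx (i + 1)) * pivot (i + 2)) f"
    by (simp add: app_pivot mult.assoc)
qed

theorem pivot_unique: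
  fixes w :: "nat \<Rightarrow> 'k::field grend"
  assumes w: "\<And>i. w i = gderiv i + lmult (gx i) * lmult (gx (i + 1)) * w (i + 2)"
  shows "w = pivot"
proof (rule ext, rule grend_eqI)
  fix i f
  define d where "d i = app (w i) f - app (pivot i) f" for i
  have d: "d i = gx i * gx (i + 1) * d (i + 2)" for i
    unfolding d_def by (subst w, subst pivot_rec) (simp add: right_diff_distrib mult.assoc)
  have support: "coef (d i) A \<noteq> 0 \<Longrightarrow> {i..<i + 2 * n} \<subseteq> A" for n i A
  proof (induction n arbitrary: i A)
    case (Suc n)
    have fin: "finite A" using Suc.prems coef_infinite by blast
    have "coef (gx i * (gx (i + 1) * d (i + 2))) A \<noteq> 0"
      using Suc.prems d[of i] by (simp add: mult.assoc)
    then have "i \<in> A" "coef (gx (i + 1) * d (i + 2)) (A - {i}) \<noteq> 0"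
      using fin by (auto simp: coef_gx_mult split: if_splits)
    moreover from this have "i + 1 \<in> A" "coef (d (i + 2)) (A - {i} - {i + 1}) \<noteq> 0"
      using fin by (auto simp: coef_gx_mult split: if_splits)
    ultimately have "i \<in> A" "i + 1 \<in> A" "{i + 2..<i + 2 + 2 * n} \<subseteq> A"
      using Suc.IH[of "i + 2" "A - {i} - {i + 1}"] by auto
    moreover have "{i..<i + 2 * Suc n} = {i, i + 1} \<union> {i + 2..<i + 2 + 2 * n}" by auto
    ultimately show ?case by simp
  qed simp
  have "coef (d i) A = 0" if "finite A" for A
  proof (rule ccontr)
    assume "coef (d i) A \<noteq> 0"
    then have "card {i..<i + 2 * Suc (card A)} \<le> card A"
      by (intro card_mono that support)
    then show False by simp
  qed
  then have "d i = 0" by (intro grassmann_eqI) simp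
  then show "app (w i) f = app (pivot i) f" by (simp add: d_def)
qed

section \<open>Lie superalgebras of endomorphisms and just infiniteness\<close>

definition graded_subspace :: "'k::field grend set \<Rightarrow> bool" where
  "graded_subspace S \<longleftrightarrow> gend.subspace S \<and> (\<forall>D\<in>S. \<forall>p. ecomp p D \<in> S)"

definition lie_subsuperalgebra :: "'k::field grend set \<Rightarrow> bool" where
  "lie_subsuperalgebra S \<longleftrightarrow> graded_subspace S \<and>
     (\<forall>D\<in>S. \<forall>E\<in>S. sbracket D E \<in> S) \<and>
     (CHAR('k) = 2 \<longrightarrow> (\<forall>D\<in>S. ehom 1 D \<longrightarrow> D ^ 2 \<in> S))"

definition lie_generated :: "'k::field grend set \<Rightarrow> 'k grend set" where
  "lie_generated X = \<Inter> {S. lie_subsuperalgebra S \<and> X \<subseteq> S}"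

lemma lie_subsuperalgebra_lie_generated: "lie_subsuperalgebra (lie_generated X)"
  unfolding lie_subsuperalgebra_def graded_subspace_def lie_generated_def gend.subspace_def
  by blast

text \<open>Ideals are not required to be graded.\<close>

definition lie_ideal :: "'k::field grend set \<Rightarrow> 'k grend set \<Rightarrow> bool" where
  "lie_ideal J R \<longleftrightarrow> J \<subseteq> R \<and> gend.subspace J \<and>
     (\<forall>D\<in>R. \<forall>E\<in>J. sbracket D E \<in> J) \<and>
     (CHAR('k) = 2 \<longrightarrow> (\<forall>D\<in>J. ehom 1 D \<longrightarrow> D ^ 2 \<in> J))"

definition finite_dimensional :: "'k::field grend set \<Rightarrow> bool" where
  "finite_dimensional S \<longleftrightarrow> (\<exists>B. finite B \<and> B \<subseteq> S \<and> gend.span B = S)"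

text \<open>\<open>R / J\<close> is spanned by the classes of the elements of \<open>B\<close>.\<close>

definition finite_codimension :: "'k::field grend set \<Rightarrow> 'k grend set \<Rightarrow> bool" where
  "finite_codimension J R \<longleftrightarrow>
     (\<exists>B. finite B \<and> B \<subseteq> R \<and> (\<forall>D\<in>R. \<exists>E\<in>gend.span B. D - E \<in> J))"

definition just_infinite :: "'k::field grend set \<Rightarrow> bool" where
  "just_infinite R \<longleftrightarrow> \<not> finite_dimensional R \<and>
     (\<forall>J. lie_ideal J R \<and> J \<noteq> {0} \<longrightarrow> finite_codimension J R)"

definition pivot_superalgebra :: "'k::field grend set" where
  "pivot_superalgebra = lie_generated {pivot 0, pivot 1}"

end

theory Submission
  imports Defs
begin

text \<open>
  Write \<open>\<sigma>\<close> for the grade involution and \<open>x\<^sub>A\<close> for the monomial with letters in \<open>A\<close>. Everything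
  is computed from \<open>[v\<^sub>i, f v\<^sub>m] = v\<^sub>i(f) v\<^sub>m + \<sigma>(f) [v\<^sub>i, v\<^sub>m]\<close>, where for \<open>i \<le> m\<close> the bracket
  \<open>[v\<^sub>i, v\<^sub>m]\<close> equals \<open>- x\<^sub>i \<cdots> x\<^bsub>m-1\<^esub> v\<^bsub>m+1\<^esub>\<close> if \<open>m - i\<close> is odd and
  \<open>2 x\<^sub>i \<cdots> x\<^bsub>m-1\<^esub> x\<^bsub>m+1\<^esub> v\<^bsub>m+2\<^esub>\<close> if it is even. In particular \<open>v\<^sub>i\<close> strips the letter
  \<open>x\<^sub>i\<close> off \<open>x\<^sub>A v\<^sub>m\<close> whenever \<open>i \<in> A\<close>, so \<open>v\<^sub>i\<^sup>2 = x\<^bsub>i+1\<^esub> v\<^bsub>i+2\<^esub>\<close> puts all pivots into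
  \<open>\<^bold>R\<close>.

  The algebra \<open>\<^bold>R\<close> lies in the span of the \<open>x\<^sub>A v\<^sub>m\<close> with \<open>A \<subseteq> {0, \<dots>, m - 1}\<close> such that
  \<open>m - 1 \<in> A\<close> implies \<open>m - 2 \<notin> A\<close> (in characteristic 2: implies \<open>A = {m - 1}\<close>). An ideal
  containing some \<open>v\<^sub>n\<close>, \<open>n \<ge> 1\<close>, contains all such \<open>x\<^sub>A v\<^sub>m\<close> with \<open>m \<ge> n + 4\<close>, because the
  largest ones arise as brackets and the others by stripping letters; so it has finite codimension.

  Every nonzero ideal contains such a \<open>v\<^sub>n\<close>. Repeated use of the recursion for the pivots writes
  an element as \<open>\<Sum>\<^bsub>n<N\<^esub> h\<^sub>n \<partial>\<^sub>n + f v\<^sub>N + g v\<^bsub>N+1\<^esub>\<close> with \<open>h\<^sub>n\<close> in the letters below \<open>n\<close>,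
  and a few brackets isolate a nonzero element \<open>u x\<^sub>M v\<^bsub>M+2\<^esub>\<close> with \<open>u\<close> in the letters below \<open>M\<close>.
  The leading letters of \<open>u\<close> can then be removed one after the other by brackets that replace \<open>u\<close>
  with \<open>v\<^sub>i(u)\<close> and \<open>M\<close> with \<open>M + 1\<close>.
\<close>

section \<open>Grade involution, supercommutators and odd superderivations\<close>

text \<open>For disjoint finite \<open>A\<close> and \<open>B\<close> every pair in
  \<open>A \<times> B\<close> is an inversion in exactly one of the two orders, so
  \<open>inversions A B + inversions B A = card A * card B\<close>. Reindexing by complements in
  \<open>C\<close> turns this into the sign rule.\<close>

lemma gmult_supercommute:
  assumes "ghom p f" "ghom q g"
  shows "f * g = gscale ((- 1) ^ (p * q)) (g * (f :: 'k::field grassmann))"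
proof (rule grassmann_eqI)
  fix C :: "nat set" assume C: "finite C"
  have "coef (f * g) C = (\<Sum>A\<in>Pow C. (- 1) ^ inversions (C - A) A * coef f (C - A) * coef g A)"
    unfolding coef_mult
    by (rule sum.reindex_bij_witness[where i = "\<lambda>A. C - A" and j = "\<lambda>A. C - A"])
      (auto simp: double_diff)
  also have "\<dots> = (\<Sum>A\<in>Pow C. (- 1) ^ (p * q) *
      ((- 1) ^ inversions A (C - A) * coef g A * coef f (C - A)))"
  proof (rule sum.cong[OF refl])
    fix A assume "A \<in> Pow C"
    define B where "B = C - A"
    have AB: "finite A" "finite B" "A \<inter> B = {}"
      using \<open>A \<in> Pow C\<close> C unfolding B_def by (auto intro: finite_subset)
    have "A \<times> B = {(a, b). a \<in> A \<and> b \<in> B \<and> b < a} \<union> prod.swap ` {(b, a). b \<in> B \<and> a \<in> A \<and> a < b}"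
    proof (intro equalityI subsetI)
      fix x assume "x \<in> A \<times> B"
      then obtain a b where x: "x = (a, b)" "a \<in> A" "b \<in> B" by blast
      then have "b < a \<or> a < b" using AB(3) by (metis disjoint_iff linorder_neqE_nat)
      then show "x \<in> {(a, b). a \<in> A \<and> b \<in> B \<and> b < a} \<union> prod.swap ` {(b, a). b \<in> B \<and> a \<in> A \<and> a < b}"
        using x by (auto intro: rev_image_eqI[of "(b, a)"])
    qed auto
    then have "card (A \<times> B) = card {(a, b). a \<in> A \<and> b \<in> B \<and> b < a}
       + card (prod.swap ` {(b, a). b \<in> B \<and> a \<in> A \<and> a < b})"
      using finite_inversions[OF AB(1,2)] finite_inversions[OF AB(2,1)]
      by (simp only:, intro card_Un_disjoint finite_imageI) auto
    also have "card (prod.swap ` {(b, a). b \<in> B \<and> a \<in> A \<and> a < b}) = inversions B A"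
      unfolding inversions_def by (rule card_image) (simp add: inj_on_def)
    finally have inv: "inversions A B + inversions B A = card A * card B"
      unfolding inversions_def[of A B] card_cartesian_product by simp
    show "(- 1) ^ inversions (C - A) A * coef f (C - A) * coef g A =
      (- 1) ^ (p * q) * ((- 1) ^ inversions A (C - A) * coef g A * coef f (C - A))"
    proof (cases "coef f B = 0 \<or> coef g A = 0")
      case False
      then have "even (card B) = even p" "even (card A) = even q"
        using assms unfolding ghom_def by auto
      then have "even (inversions B A) = even (p * q + inversions A B)"
        using inv by (metis even_add even_mult_iff)
      then show ?thesis
        using minus_one_power_cong[of "inversions B A" "p * q + inversions A B", where 'a = 'k]
        unfolding B_def[symmetric] by (simp add: power_add)
    qed (auto simp: B_def)
  qed
  also have "\<dots> = coef (gscale ((- 1) ^ (p * q)) (g * f)) C"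
    by (simp add: coef_mult sum_distrib_left)
  finally show "coef (f * g) C = coef (gscale ((- 1) ^ (p * q)) (g * f)) C" .
qed

lemma coef_mult_nonzeroE:
  assumes "coef (f * g) C \<noteq> 0"
  obtains A B where "coef f A \<noteq> 0" "coef g B \<noteq> 0" "A \<inter> B = {}" "C = A \<union> B"
proof -
  obtain A where A: "A \<in> Pow C" "(- 1) ^ inversions A (C - A) * coef f A * coef g (C - A) \<noteq> 0"
    using assms unfolding coef_mult by (rule sum.not_neutral_contains_not_neutral)
  then show thesis by (intro that[of A "C - A"]) auto
qed

text \<open>Carries the sign of the super Leibniz rule, so that the rule can be stated for elements
  that are not homogeneous.\<close>

definition ginvol :: "'k::field grassmann \<Rightarrow> 'k grassmann" where
  "ginvol f = gcomp 0 f - gcomp 1 f"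

lemma coef_ginvol: "coef (ginvol f) A = (- 1) ^ card A * coef f A"
  by (simp add: ginvol_def coef_gcomp)

lemma ginvol_ghom: "ghom p f \<Longrightarrow> ginvol f = gscale ((- 1) ^ p) f"
  by (rule grassmann_eqI) (auto simp: coef_ginvol ghom_def intro: minus_one_power_cong)

lemma ginvol_add: "ginvol (f + g) = ginvol f + ginvol g"
  and ginvol_zero [simp]: "ginvol 0 = 0"
  and ginvol_ginvol [simp]: "ginvol (ginvol f) = f"
  and ginvol_gx: "ginvol (gx i) = - gx i"
  by (rule grassmann_eqI, simp add: coef_ginvol coef_gx algebra_simps)+

lemma ginvol_monom: "ginvol (monom A) = gscale ((- 1) ^ card A) (monom A)"
  by (rule grassmann_eqI) (auto simp: coef_ginvol monom.rep_eq)

lemma ginvol_eq_0_iff [simp]: "ginvol f = 0 \<longleftrightarrow> f = 0"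
  by (metis ginvol_ginvol ginvol_zero)

lemma ginvol_mult: "ginvol (f * g) = ginvol f * (ginvol g :: 'k::field grassmann)"
proof (rule grassmann_eqI)
  fix C :: "nat set" assume C: "finite C"
  have "(- 1 :: 'k) ^ card C = (- 1) ^ card A * (- 1) ^ card (C - A)" if "A \<subseteq> C" for A
    using that C
    by (metis card_Un_disjoint Diff_disjoint Un_Diff_cancel finite_Diff finite_subset
        power_add subset_Un_eq)
  then show "coef (ginvol (f * g)) C = coef (ginvol f * ginvol g) C"
    by (simp add: coef_mult coef_ginvol sum_distrib_left mult_ac)
qed

lemma gx_mult_commute: "gx i * f = ginvol f * gx i"
proof -
  have *: "gx i * gcomp p f = gscale ((- 1) ^ p) (gcomp p f * gx i)" for p
    using gmult_supercommute[of 1 "gx i" p "gcomp p f"] ghom_gcomp[of p f]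
    by (simp add: ghom_def coef_gx)
  have "gx i * f = gx i * gcomp 0 f + gx i * gcomp 1 f"
    by (metis distrib_left gcomp_sum)
  also have "\<dots> = ginvol f * gx i"
    unfolding * ginvol_def by (simp add: left_diff_distrib)
  finally show ?thesis .
qed

lemma monom_mult:
  assumes "finite A" "finite B" "A \<inter> B = {}"
  shows "monom A * monom B = gscale ((- 1) ^ inversions A B) (monom (A \<union> B) :: 'k::field grassmann)"
proof (rule grassmann_eqI)
  fix C :: "nat set" assume C: "finite C"
  have "coef (monom A * monom B :: 'k grassmann) C =
      (\<Sum>D\<in>Pow C. if D = A then if C = A \<union> B then (- 1) ^ inversions A B else 0 else 0)"
    unfolding coef_mult
  proof (rule sum.cong[OF refl])
    fix D assume "D \<in> Pow C"
    then have "C - A = B \<longleftrightarrow> C = A \<union> B" if "D = A" using that assms(3) by blast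
    then show "(- 1) ^ inversions D (C - D) * coef (monom A) D * coef (monom B) (C - D) =
      (if D = A then if C = A \<union> B then (- 1 :: 'k) ^ inversions A B else 0 else 0)"
      using assms by (auto simp: monom.rep_eq)
  qed
  then show "coef (monom A * monom B) C =
      coef (gscale ((- 1) ^ inversions A B) (monom (A \<union> B) :: 'k grassmann)) C"
    using assms C by (simp add: monom.rep_eq)
qed

lemma monom_mult_eq_0: "A \<inter> B \<noteq> {} \<Longrightarrow> monom A * monom B = 0"
proof (rule grassmann_eqI, rule ccontr)
  fix C assume "A \<inter> B \<noteq> {}" "coef (monom A * monom B :: 'a grassmann) C \<noteq> coef 0 C"
  then have "coef (monom A * monom B :: 'a grassmann) C \<noteq> 0" by simp
  then obtain A' B' where "coef (monom A :: 'a grassmann) A' \<noteq> 0" "coef (monom B :: 'a grassmann) B' \<noteq> 0" "A' \<inter> B' = {}"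
    by (rule coef_mult_nonzeroE)
  then show False
    using \<open>A \<inter> B \<noteq> {}\<close> by (simp add: monom.rep_eq split: if_splits)
qed

section \<open>Left multiplications and bilinearity of the supercommutator\<close>

lemma lmult_mult: "lmult (f * g) = lmult f * lmult g"
  and lmult_add: "lmult (f + g) = lmult f + lmult g"
  and lmult_uminus: "lmult (- f) = - lmult f"
  and lmult_zero [simp]: "lmult 0 = 0"
  and lmult_one [simp]: "lmult 1 = 1"
  and lmult_gscale: "lmult (gscale c f) = escale c (lmult f)"
  by (rule grend_eqI, simp add: mult.assoc distrib_right escale.rep_eq gscale_mult_left)+

lemma escale_mult_left: "escale c D * E = escale c (D * E)"
  and escale_mult_right: "D * escale c E = escale c (D * E)"
  by (rule grend_eqI, simp add: escale.rep_eq app_gscale)+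

lemma lmult_ehom: "ghom p f \<Longrightarrow> ehom p (lmult f)"
  unfolding ehom_def
proof (intro allI impI)
  fix q g assume "ghom p f" "ghom q (g :: 'a grassmann)"
  then have "even (card C) = even (p + q)" if nz: "coef (f * g) C \<noteq> 0" for C
  proof -
    obtain A B where AB: "coef f A \<noteq> 0" "coef g B \<noteq> 0" "A \<inter> B = {}" "C = A \<union> B"
      using nz by (rule coef_mult_nonzeroE)
    then have "finite A" "finite B" using coef_infinite by blast+
    then show ?thesis
      using AB \<open>ghom p f\<close> \<open>ghom q g\<close> by (simp add: ghom_def card_Un_disjoint)
  qed
  then show "ghom (p + q) (app (lmult f) g)" by (simp add: ghom_def)
qed

lemma ehom_mult: "ehom p D \<Longrightarrow> ehom q E \<Longrightarrow> ehom (p + q) (D * E)"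
  unfolding ehom_def by (simp add: add.assoc)

lemma ecomp_add: "ecomp p (D + E) = ecomp p D + ecomp p E"
  and ecomp_escale: "ecomp p (escale c D) = escale c (ecomp p D)"
  and ecomp_zero [simp]: "ecomp p 0 = 0"
  unfolding ecomp_def
  by (simp_all add: distrib_left distrib_right sum.distrib escale_mult_left escale_mult_right
      gend.scale_sum_right)

lemma sbracket_add_left: "sbracket (D + D') E = sbracket D E + sbracket D' E"
  and sbracket_add_right: "sbracket D (E + E') = sbracket D E + sbracket D E'"
  unfolding sbracket_def ecomp_add sum.distrib[symmetric]
  by (intro sum.cong refl, simp add: algebra_simps)+

lemma minus_one_power_mult_escale: "(- 1) ^ n * D = escale ((- 1) ^ n) (D :: 'k::field grend)"
  by (cases "even n") simp_all

lemma sbracket_escale_left: "sbracket (escale c D) E = escale c (sbracket D E)"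
  and sbracket_escale_right: "sbracket D (escale c E) = escale c (sbracket D E)"
  unfolding sbracket_def ecomp_escale minus_one_power_mult_escale
  by (simp_all only: gend.scale_sum_right escale_mult_left escale_mult_right
      gend.scale_right_diff_distrib gend.scale_scale mult.commute[of _ c])

lemma sbracket_zero [simp]: "sbracket 0 E = 0" "sbracket D 0 = 0"
  by (simp_all add: sbracket_def)

lemma sbracket_sum_right: "sbracket D (\<Sum>i\<in>S. E i) = (\<Sum>i\<in>S. sbracket D (E i))"
  by (induction S rule: infinite_finite_induct) (simp_all add: sbracket_add_right)

lemma sbracket_commute:
  assumes "ehom p D" "ehom q E"
  shows "sbracket E D = escale (- ((- 1) ^ (p * q))) (sbracket D E)"
  unfolding sbracket_ehom[OF assms] sbracket_ehom[OF assms(2,1)] minus_one_power_mult_escale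
  by (simp add: gend.scale_right_diff_distrib mult.commute[of q p] flip: power_add)

section \<open>Anticommutators and the Leibniz rule\<close>

text \<open>Between odd elements this is the supercommutator (\<open>sbracket_odd\<close>), but
  without parity components, so it can be computed directly.\<close>

definition anticomm :: "'k::field grend \<Rightarrow> 'k grend \<Rightarrow> 'k grend" where
  "anticomm D E = D * E + E * D"

lemma anticomm_commute: "anticomm D E = anticomm E D"
  by (simp add: anticomm_def add.commute)

lemma anticomm_add_right: "anticomm D (E + E') = anticomm D E + anticomm D E'"
  by (simp add: anticomm_def algebra_simps)

text \<open>The Leibniz rule as an identity of operators, obtained by adding the rules for the even
  and the odd component of \<open>f\<close>.\<close>

lemma odd_superderivation_lmult:
  assumes "odd_superderivation v"
  shows "v * lmult f = lmult (app v f) + lmult (ginvol f) * v"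
proof (rule grend_eqI)
  fix g
  have *: "app v (gcomp p f * g) = app v (gcomp p f) * g + (- 1) ^ p * (gcomp p f * app v g)" for p
    using assms ghom_gcomp[of p f] unfolding odd_superderivation_def by blast
  have "app v (f * g) = app v (gcomp 0 f * g) + app v (gcomp 1 f * g)"
    by (metis app_add distrib_right gcomp_sum)
  also have "\<dots> = (app v (gcomp 0 f) + app v (gcomp 1 f)) * g + ginvol f * app v g"
    unfolding * ginvol_def by (simp add: algebra_simps)
  finally show "app (v * lmult f) g = app (lmult (app v f) + lmult (ginvol f) * v) g"
    by (simp only: app_gcomp_sum app_simps app_lmult)
qed

lemma app_odd_superderivation_mult:
  "odd_superderivation v \<Longrightarrow> app v (f * g) = app v f * g + ginvol f * app v g"
  using arg_cong[OF odd_superderivation_lmult[of v f], of "\<lambda>D. app D g"] by simp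

lemma anticomm_lmult:
  assumes "odd_superderivation v" "ginvol f = f"
  shows "anticomm v (lmult f * w) = lmult (app v f) * w + lmult f * anticomm v w"
  using odd_superderivation_lmult[OF assms(1), of f] assms(2)
  by (simp add: anticomm_def algebra_simps flip: mult.assoc)

lemma sbracket_odd:
  "ehom 1 v \<Longrightarrow> ehom 1 w \<Longrightarrow> sbracket v w = anticomm v w"
  by (simp add: sbracket_ehom anticomm_def)

text \<open>For \<open>f\<close> of degree \<open>p\<close>, the sign
  \<open>-(-1)^(p+1) = (-1)^p\<close> of the supercommutator is the one that the Leibniz rule puts
  on \<open>f\<close>, so the two remaining products combine to an anticommutator. Additivity
  extends this to all \<open>f\<close>.\<close>

lemma sbracket_odd_lmult:
  assumes v: "odd_superderivation v" and w: "ehom 1 w"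
  shows "sbracket v (lmult f * w) = lmult (app v f) * w + lmult (ginvol f) * anticomm v w"
proof -
  have hom: "sbracket v (lmult f * w) = lmult (app v f) * w + lmult (ginvol f) * anticomm v w"
    if f: "ghom p f" for f p
  proof -
    have e: "ehom 1 v" "ehom (p + 1) (lmult f * w)"
      using v ehom_mult[OF lmult_ehom[OF f] w] by (simp_all add: odd_superderivation_def)
    have "v * (lmult f * w) = lmult (app v f) * w + lmult (ginvol f) * v * w"
      using odd_superderivation_lmult[OF v, of f] by (simp add: algebra_simps flip: mult.assoc)
    then show ?thesis
      unfolding sbracket_ehom[OF e] anticomm_def ginvol_ghom[OF f]
      by (cases "even p") (simp_all add: algebra_simps lmult_uminus)
  qed
  define g h where "g = gcomp 0 f" and "h = gcomp 1 f"
  have f: "f = g + h" unfolding g_def h_def by (rule gcomp_sum[symmetric])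
  have "sbracket v (lmult f * w) = sbracket v (lmult g * w) + sbracket v (lmult h * w)"
    unfolding f lmult_add distrib_right sbracket_add_right ..
  also have "\<dots> = lmult (app v f) * w + lmult (ginvol f) * anticomm v w"
    unfolding f lmult_add distrib_right app_add ginvol_add
    unfolding g_def h_def hom[OF ghom_gcomp] by (simp only: add_ac)
  finally show ?thesis .
qed

section \<open>Anticommutators of the pivot elements\<close>

text \<open>For \<open>i < j\<close>, inserting \<open>i\<close> adds one letter below
  \<open>j\<close>, whereas inserting \<open>j\<close> adds none below \<open>i\<close>; hence the
  two orders differ by a sign.\<close>

lemma anticomm_gderiv: "anticomm (gderiv i) (gderiv j) = 0"
proof -
  have less: "anticomm (gderiv i) (gderiv j) = (0 :: 'a grend)" if "i < j" for i j
  proof (rule grend_eqI, rule grassmann_eqI)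
    fix f :: "'a grassmann" and A :: "nat set"
    assume A: "finite A"
    show "coef (app (anticomm (gderiv i) (gderiv j)) f) A = coef (app 0 f) A"
    proof (cases "i \<in> A \<or> j \<in> A")
      case False
      then have "{a \<in> insert i A. a < j} = insert i {a \<in> A. a < j}"
        "{a \<in> insert j A. a < i} = {a \<in> A. a < i}" "insert i (insert j A) = insert j (insert i A)"
        using that by auto
      then show ?thesis using False A that
        by (simp add: anticomm_def coef_gderiv del: insert_iff Collect_empty_eq)
          (simp add: card_insert_if)
    qed (auto simp: anticomm_def coef_gderiv)
  qed
  have "anticomm (gderiv i) (gderiv i) = (0 :: 'a grend)"
    by (rule grend_eqI, rule grassmann_eqI) (simp add: anticomm_def coef_gderiv)
  then show ?thesis
    using less[of i j] less[of j i] anticomm_commute[of "gderiv i" "gderiv j"]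
    by (metis linorder_neqE_nat)
qed

lemma gderiv_square: "gderiv i * gderiv i = 0"
  by (rule grend_eqI, rule grassmann_eqI) (simp add: coef_gderiv)

section \<open>Support of a pivot's values, and pivots as odd superderivations\<close>

lemma coef_pivot_coeff_nonzero: "coef (pivot_coeff i k :: 'k::field grassmann) A \<noteq> 0 \<Longrightarrow> A = {i..<i + 2 * k}"
proof (induction k arbitrary: i A)
  case 0
  then show ?case by (simp split: if_splits)
next
  case (Suc k)
  then have "coef (gx i * (gx (i + 1) * pivot_coeff (i + 2) k) :: 'k grassmann) A \<noteq> 0"
    by (simp add: mult.assoc)
  then obtain B where B: "A = {i} \<union> B" "coef (gx (i + 1) * pivot_coeff (i + 2) k :: 'k grassmann) B \<noteq> 0"
    by (rule coef_mult_nonzeroE) (auto simp: coef_gx split: if_splits)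
  from B(2) obtain C where C: "B = {i + 1} \<union> C" "coef (pivot_coeff (i + 2) k :: 'k grassmann) C \<noteq> 0"
    by (rule coef_mult_nonzeroE) (auto simp: coef_gx split: if_splits)
  then have "A = {i} \<union> {i + 1} \<union> {i + 2..<i + 2 + 2 * k}"
    using B Suc.IH[of "i + 2" C] by auto
  also have "\<dots> = {i..<i + 2 * Suc k}" by auto
  finally show ?case .
qed

text \<open>On monomials, \<open>v_i\<close> trades a letter \<open>j\<close> at even distance above
  \<open>i\<close> for the block \<open>{i..<j}\<close>. The statements below on where
  \<open>v_i\<close> vanishes or which letters it can produce rest on this.\<close>

lemma coef_pivot_nonzeroE:
  assumes "coef (app (pivot i) f) C \<noteq> 0"
  obtains j B where "coef f B \<noteq> 0" "j \<in> B" "i \<le> j" "even (j - i)"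
    "C = {i..<j} \<union> (B - {j})" "{i..<j} \<inter> B = {}"
proof -
  obtain N where N: "pivot_raw i f = (\<Sum>k<N. pivot_coeff i k * app (gderiv (i + 2 * k)) f)"
    using pivot_raw_bound[of i f] by blast
  then have "(\<Sum>k<N. coef (pivot_coeff i k * app (gderiv (i + 2 * k)) f) C) \<noteq> 0"
    using assms by (simp add: app_pivot)
  then obtain k where "coef (pivot_coeff i k * app (gderiv (i + 2 * k)) f) C \<noteq> 0"
    by (rule sum.not_neutral_contains_not_neutral)
  then obtain A D where AD: "coef (pivot_coeff i k) A \<noteq> (0 :: 'a)"
    "coef (app (gderiv (i + 2 * k)) f) D \<noteq> 0" "A \<inter> D = {}" "C = A \<union> D"
    by (rule coef_mult_nonzeroE)
  then have "A = {i..<i + 2 * k}" "i + 2 * k \<notin> D" "coef f (insert (i + 2 * k) D) \<noteq> 0"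
    using coef_pivot_coeff_nonzero[of i k A] by (auto simp: coef_gderiv split: if_splits)
  with AD show thesis
    by (intro that[of "insert (i + 2 * k) D" "i + 2 * k"]) auto
qed

lemma ginvol_even_pair: "ginvol (gx i * gx j) = gx i * gx j"
  by (simp add: ginvol_mult ginvol_gx)

text \<open>A product of an even number of letters is central: moving a pair of letters past
  \<open>h\<close> applies the grade involution twice.\<close>

lemma pivot_coeff_commute: "pivot_coeff i k * f = f * pivot_coeff i k"
proof (induction k arbitrary: i)
  case (Suc k)
  have g: "gx i * (gx (i + 1) * h) = h * (gx i * gx (i + 1))" for h :: "'a grassmann"
    using gx_mult_commute[of "i + 1" h] gx_mult_commute[of i "ginvol h * gx (i + 1)"]
      gx_anticommute[of "i + 1" i, where 'k = 'a]
    by (simp add: ginvol_mult ginvol_gx mult.assoc)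
  have "pivot_coeff i (Suc k) * f = gx i * (gx (i + 1) * (f * pivot_coeff (i + 2) k))"
    using Suc.IH[of "i + 2"] by (simp add: mult.assoc)
  also have "\<dots> = f * (pivot_coeff (i + 2) k * (gx i * gx (i + 1)))"
    unfolding g by (simp only: mult.assoc)
  also have "\<dots> = f * pivot_coeff i (Suc k)"
    unfolding g[symmetric] by (simp add: mult.assoc)
  finally show ?case .
qed simp

lemma odd_superderivation_pivot: "odd_superderivation (pivot i :: 'k::field grend)"
  unfolding odd_superderivation_def ehom_def
proof (intro conjI allI impI)
  fix q and f :: "'k grassmann"
  assume f: "ghom q f"
  show "ghom (1 + q) (app (pivot i) f)"
    unfolding ghom_def
  proof (intro allI impI)
    fix C assume "coef (app (pivot i) f) C \<noteq> 0"
    then obtain j B where jB: "coef f B \<noteq> 0" "j \<in> B" "i \<le> j" "even (j - i)"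
      "C = {i..<j} \<union> (B - {j})" "{i..<j} \<inter> B = {}"
      by (rule coef_pivot_nonzeroE)
    have B: "finite B" "even (card B) = even q"
      using f jB coef_infinite unfolding ghom_def by blast+
    \<comment> \<open>The even number \<open>j - i\<close> of letters is gained and one letter is
      lost, so the parity flips.\<close>
    have "card C = (j - i) + (card B - 1)" "card B > 0"
      using jB B(1) card_gt_0_iff by (auto simp: card_Un_disjoint disjoint_iff)
    then show "even (card C) = even (1 + q)" using jB(4) B(2) by presburger
  qed
next
  fix p and f g :: "'k grassmann"
  assume f: "ghom p f"
  let ?S = "\<lambda>n h. \<Sum>k<n. pivot_coeff i k * app (gderiv (i + 2 * k)) h"
  obtain N1 where 1: "\<And>n. N1 \<le> n \<Longrightarrow> pivot_raw i (f * g) = ?S n (f * g)"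
    using pivot_raw_bound[of i "f * g"] by auto
  obtain N2 where 2: "\<And>n. N2 \<le> n \<Longrightarrow> pivot_raw i f = ?S n f"
    using pivot_raw_bound[of i f] by auto
  obtain N3 where 3: "\<And>n. N3 \<le> n \<Longrightarrow> pivot_raw i g = ?S n g"
    using pivot_raw_bound[of i g] by auto
  define n where "n = max N1 (max N2 N3)"
  have *: "pivot_coeff i k * (f * h) = f * (pivot_coeff i k * h)" for k h
    by (metis mult.assoc pivot_coeff_commute)
  \<comment> \<open>With a common truncation \<open>n\<close>, the Leibniz rule holds term by term
    because each coefficient is central.\<close>
  have "?S n (f * g) = ?S n f * g + gscale ((- 1) ^ p) (f * ?S n g)"
    unfolding gderiv_mult[OF f] minus_one_power_mult
    by (simp add: * distrib_left gscale_mult_right sum.distrib sum_distrib_right sum_distrib_left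
        gr.scale_sum_right mult.assoc)
  then show "app (pivot i) (f * g) = app (pivot i) f * g + (- 1) ^ p * (f * app (pivot i) g)"
    using 1[of n] 2[of n] 3[of n]
    unfolding app_pivot minus_one_power_mult n_def by simp
qed

lemma ehom_pivot: "ehom 1 (pivot i)" and ehom_gderiv: "ehom 1 (gderiv i)"
  using odd_superderivation_pivot odd_superderivation_gderiv
  unfolding odd_superderivation_def by blast+

lemma pivot_rec': "pivot i = gderiv i + lmult (gx i * gx (i + 1)) * pivot (i + 2)"
  using pivot_rec[of i] by (simp add: lmult_mult)

section \<open>The filtration by letters below a bound\<close>

definition grassmann_below :: "nat \<Rightarrow> 'k::field grassmann set" where
  "grassmann_below n = {f. \<forall>A. coef f A \<noteq> 0 \<longrightarrow> A \<subseteq> {..<n}}"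

lemma grassmann_belowD: "f \<in> grassmann_below n \<Longrightarrow> coef f A \<noteq> 0 \<Longrightarrow> A \<subseteq> {..<n}"
  by (simp add: grassmann_below_def)

lemma grassmann_below_mono: "f \<in> grassmann_below n \<Longrightarrow> n \<le> m \<Longrightarrow> f \<in> grassmann_below m"
  unfolding grassmann_below_def by fastforce

lemma grassmann_below_add:
  "f \<in> grassmann_below n \<Longrightarrow> g \<in> grassmann_below n \<Longrightarrow> f + g \<in> grassmann_below n"
  unfolding grassmann_below_def
proof (intro CollectI allI impI)
  fix A assume *: "f \<in> {f. \<forall>A. coef f A \<noteq> 0 \<longrightarrow> A \<subseteq> {..<n}}"
    "g \<in> {f. \<forall>A. coef f A \<noteq> 0 \<longrightarrow> A \<subseteq> {..<n}}" and "coef (f + g) A \<noteq> 0"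
  then have "coef f A \<noteq> 0 \<or> coef g A \<noteq> 0" by auto
  then show "A \<subseteq> {..<n}" using * by blast
qed

lemma grassmann_below_zero: "0 \<in> grassmann_below n"
  and grassmann_below_gscale: "f \<in> grassmann_below n \<Longrightarrow> gscale c f \<in> grassmann_below n"
  and grassmann_below_ginvol: "f \<in> grassmann_below n \<Longrightarrow> ginvol f \<in> grassmann_below n"
  by (auto simp: grassmann_below_def coef_ginvol)

lemma grassmann_below_mult:
  "f \<in> grassmann_below n \<Longrightarrow> g \<in> grassmann_below n \<Longrightarrow> f * g \<in> grassmann_below n"
  unfolding grassmann_below_def
proof (intro CollectI allI impI)
  fix C assume "f \<in> {f. \<forall>A. coef f A \<noteq> 0 \<longrightarrow> A \<subseteq> {..<n}}"
    "g \<in> {f. \<forall>A. coef f A \<noteq> 0 \<longrightarrow> A \<subseteq> {..<n}}" "coef (f * g) C \<noteq> 0"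
  then show "C \<subseteq> {..<n}" 
    by (elim coef_mult_nonzeroE) blast
qed

lemma grassmann_below_gx: "i < n \<Longrightarrow> gx i \<in> grassmann_below n"
  and grassmann_below_monom: "A \<subseteq> {..<n} \<Longrightarrow> monom A \<in> grassmann_below n"
  by (auto simp: grassmann_below_def coef_gx monom.rep_eq split: if_splits)

text \<open>Every term of \<open>v_i\<close> differentiates by a letter \<open>j \<ge> i\<close>,
  and no such letter occurs in \<open>f\<close>.\<close>

lemma pivot_below_eq_0: "f \<in> grassmann_below n \<Longrightarrow> n \<le> i \<Longrightarrow> app (pivot i) f = 0"
proof (rule grassmann_eqI, rule ccontr)
  fix C assume f: "f \<in> grassmann_below n" "n \<le> i" and "coef (app (pivot i) f) C \<noteq> coef 0 C"
  then have "coef (app (pivot i) f) C \<noteq> 0" by simp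
  then obtain j B where "coef f B \<noteq> 0" "j \<in> B" "i \<le> j"
    by (rule coef_pivot_nonzeroE)
  then show False using grassmann_belowD[OF f(1)] f(2) by fastforce
qed

lemma grassmann_below_gderiv:
  assumes "f \<in> grassmann_below (Suc i)"
  shows "app (gderiv i) f \<in> grassmann_below i"
  unfolding grassmann_below_def
proof (intro CollectI allI impI)
  fix A assume "coef (app (gderiv i) f) A \<noteq> 0"
  then have "i \<notin> A" "insert i A \<subseteq> {..<Suc i}"
    using assms by (auto simp: coef_gderiv split: if_splits dest!: grassmann_belowD)
  then show "A \<subseteq> {..<i}" by (auto simp: less_Suc_eq)
qed

lemma grassmann_below_pivot:
  assumes "f \<in> grassmann_below n"
  shows "app (pivot i) f \<in> grassmann_below n"
  unfolding grassmann_below_def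
proof (intro CollectI allI impI)
  fix C assume "coef (app (pivot i) f) C \<noteq> 0"
  then obtain j B where "coef f B \<noteq> 0" "j \<in> B" "C = {i..<j} \<union> (B - {j})"
    by (rule coef_pivot_nonzeroE)
  moreover from this have "B \<subseteq> {..<n}" using assms by (simp add: grassmann_belowD)
  ultimately show "C \<subseteq> {..<n}" by force
qed

text \<open>The tail \<open>v_(i+2)\<close> of the recursion vanishes on letters below
  \<open>i + 2\<close>.\<close>

lemma pivot_eq_gderiv:
  assumes "f \<in> grassmann_below (Suc (Suc i))"
  shows "app (pivot i) f = app (gderiv i) f"
  using arg_cong[OF pivot_rec'[of i], of "\<lambda>D. app D f"] pivot_below_eq_0[OF assms, of "i + 2"] by simp

lemma pivot_gx_self: "app (pivot i) (gx i) = 1"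
  by (simp add: pivot_eq_gderiv grassmann_below_gx gderiv_gx)

lemma pivot_gx_odd:
  assumes "odd (j - i)"
  shows "app (pivot i) (gx j) = 0"
proof (rule grassmann_eqI, rule ccontr)
  fix C assume "coef (app (pivot i) (gx j)) C \<noteq> coef (0 :: 'a grassmann) C"
  then have "coef (app (pivot i) (gx j :: 'a grassmann)) C \<noteq> 0" by simp
  then show False
    by (rule coef_pivot_nonzeroE) (use assms in \<open>auto simp: coef_gx split: if_splits\<close>)
qed

lemma pivot_gx_even:
  assumes "i < j"
  shows "app (pivot i) (gx j) \<in> grassmann_below j"
  unfolding grassmann_below_def
proof (intro CollectI allI impI)
  fix C assume "coef (app (pivot i) (gx j :: 'a grassmann)) C \<noteq> 0"
  then show "C \<subseteq> {..<j}"
    by (rule coef_pivot_nonzeroE) (auto simp: coef_gx split: if_splits)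
qed

section \<open>Brackets of two pivots\<close>

text \<open>The coefficients of \<open>v_m\<close> are even and free of the letter
  \<open>i < m\<close>, so \<open>gderiv i\<close> passes them, and it anticommutes with every
  \<open>gderiv j\<close>.\<close>

lemma anticomm_gderiv_pivot:
  assumes "i < m"
  shows "anticomm (gderiv i) (pivot m) = 0"
proof (rule grend_eqI)
  fix f :: "'a grassmann"
  let ?S = "\<lambda>n h. \<Sum>k<n. pivot_coeff m k * app (gderiv (m + 2 * k)) h"
  obtain N1 where 1: "\<And>n. N1 \<le> n \<Longrightarrow> pivot_raw m f = ?S n f"
    using pivot_raw_bound[of m f] by auto
  obtain N2 where 2: "\<And>n. N2 \<le> n \<Longrightarrow> pivot_raw m (app (gderiv i) f) = ?S n (app (gderiv i) f)"
    using pivot_raw_bound[of m "app (gderiv i) f"] by auto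
  define n where "n = max N1 N2"
  have P: "app (gderiv i) (pivot_coeff m k * h) = pivot_coeff m k * app (gderiv i) h"
    for k and h :: "'a grassmann"
  proof -
    have g: "ghom 0 (pivot_coeff m k :: 'a grassmann)"
      unfolding ghom_def by (auto dest!: coef_pivot_coeff_nonzero)
    have "app (gderiv i) (pivot_coeff m k) = (0 :: 'a grassmann)"
    proof (rule grassmann_eqI, rule ccontr)
      fix A assume "coef (app (gderiv i) (pivot_coeff m k)) A \<noteq> coef (0 :: 'a grassmann) A"
      then have "coef (pivot_coeff m k :: 'a grassmann) (insert i A) \<noteq> 0"
        by (auto simp: coef_gderiv split: if_splits)
      then have "i \<in> {m..<m + 2 * k}" using coef_pivot_coeff_nonzero by blast
      then show False using assms by simp
    qed
    then show ?thesis using gderiv_mult[OF g] by simp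
  qed
  have "app (gderiv i) (app (gderiv j) f) + app (gderiv j) (app (gderiv i) f) = 0" for j
    using arg_cong[OF anticomm_gderiv[of i j], of "\<lambda>D. app D f"] by (simp add: anticomm_def)
  then have "app (gderiv i) (?S n f) + ?S n (app (gderiv i) f) = 0"
    unfolding app_sum P sum.distrib[symmetric] distrib_left[symmetric] by simp
  then show "app (anticomm (gderiv i) (pivot m)) f = app 0 f"
    using 1[of n] 2[of n] unfolding n_def by (simp add: anticomm_def app_pivot)
qed

text \<open>In \<open>gderiv i + x_i x_(i+1) v_(i+2)\<close> only the derivative of the factor
  \<open>x_i\<close> survives.\<close>

lemma anticomm_gderiv_pivot_self:
  "anticomm (gderiv i) (pivot i) = lmult (gx (i + 1)) * pivot (i + 2)"
proof -
  have "app (gderiv i) (gx i * gx (i + 1)) = (gx (i + 1) :: 'a grassmann)"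
    by (simp add: app_odd_superderivation_mult[OF odd_superderivation_gderiv] gderiv_gx)
  then have "anticomm (gderiv i) (lmult (gx i * gx (i + 1)) * pivot (i + 2)) =
      (lmult (gx (i + 1)) * pivot (i + 2) :: 'a grend)"
    by (simp add: anticomm_lmult[OF odd_superderivation_gderiv ginvol_even_pair] anticomm_gderiv_pivot)
  then show ?thesis
    by (subst pivot_rec') (simp add: anticomm_add_right anticomm_gderiv)
qed

text \<open>Write \<open>v_i = gderiv i + q w\<close> with \<open>q = x_i x_(i+1)\<close> and
  \<open>w = v_(i+2)\<close>. Both summands square to zero, the second since \<open>w\<close>
  commutes with \<open>q\<close> and \<open>q q = 0\<close>; the cross terms remain.\<close>

lemma pivot_square: "pivot i * pivot i = lmult (gx (i + 1)) * pivot (i + 2)"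
proof -
  let ?q = "gx i * gx (i + 1) :: 'a grassmann" and ?w = "pivot (i + 2) :: 'a grend"
  have qq: "?q * ?q = 0"
  proof -
    have "?q * ?q = gx i * (gx (i + 1) * gx i) * gx (i + 1)" by (simp only: mult.assoc)
    also have "\<dots> = - (gx i * gx i * gx (i + 1) * gx (i + 1))"
      by (subst gx_anticommute) (simp add: mult.assoc)
    finally show ?thesis by (simp add: gx_square)
  qed
  have "app ?w ?q = 0" 
    by (intro pivot_below_eq_0[of _ "i + 2"] grassmann_below_mult grassmann_below_gx) simp_all
  then have "?w * lmult ?q = lmult ?q * ?w"
    using odd_superderivation_lmult[OF odd_superderivation_pivot, of "i + 2" ?q]
    by (simp add: ginvol_even_pair)
  then have "?w * (lmult ?q * ?w) = lmult ?q * (?w * ?w)"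
    by (simp only: mult.assoc[symmetric])
  then have "lmult ?q * ?w * (lmult ?q * ?w) = lmult (?q * ?q) * (?w * ?w)"
    by (simp only: lmult_mult mult.assoc)
  then have 0: "lmult ?q * ?w * (lmult ?q * ?w) = 0" unfolding qq by simp
  have sq: "(D + E) * (D + E) = anticomm D E" if "D * D = 0" "E * E = 0" for D E :: "'a grend"
    using that by (simp add: anticomm_def distrib_left distrib_right)
  have "pivot i * pivot i = (gderiv i + lmult ?q * ?w) * (gderiv i + lmult ?q * ?w)"
    by (simp only: pivot_rec'[symmetric])
  also have "\<dots> = anticomm (gderiv i) (lmult ?q * ?w)"
    by (rule sq[OF gderiv_square 0])
  also have "\<dots> = anticomm (gderiv i) (pivot i)"
    by (subst (2) pivot_rec') (simp add: anticomm_add_right anticomm_gderiv)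
  finally show ?thesis unfolding anticomm_gderiv_pivot_self .
qed

text \<open>One step of the recursion leaves \<open>x_i x_(i+1) [v_(i+1), v_(i+2)]\<close>. A second
  step shows that this bracket is a sum of terms beginning with \<open>x_(i+1)\<close>, which the
  prefactor kills.\<close>

lemma anticomm_pivot_Suc:
  "anticomm (pivot i) (pivot (i + 1)) = - (lmult (gx i) * pivot (i + 2))"
proof -
  have step: "anticomm (pivot (j + 1)) (pivot j) = - (lmult (gx j) * pivot (j + 2) :: 'a grend) +
      lmult (gx j * gx (j + 1)) * anticomm (pivot (j + 1)) (pivot (j + 2))" for j
  proof -
    have "app (pivot (j + 1)) (gx j * gx (j + 1)) = - (gx j :: 'a grassmann)"
      using pivot_below_eq_0[OF grassmann_below_gx[of j "j + 1"], of "j + 1", where 'a = 'a]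
      by (simp add: app_odd_superderivation_mult[OF odd_superderivation_pivot] ginvol_gx pivot_gx_self[of "Suc j"])
    then show ?thesis
      by (subst (2) pivot_rec')
        (simp add: anticomm_add_right anticomm_lmult[OF odd_superderivation_pivot ginvol_even_pair]
          anticomm_gderiv_pivot anticomm_commute[of _ "gderiv j"] lmult_uminus)
  qed
  have z: "lmult (gx i * gx (i + 1)) * (lmult (gx (i + 1) * f) * D) = 0" for f and D :: "'a grend"
  proof -
    have "gx i * gx (i + 1) * (gx (i + 1) * f) = gx i * (gx (i + 1) * gx (i + 1)) * f"
      by (simp only: mult.assoc)
    then show ?thesis by (simp add: gx_square flip: mult.assoc lmult_mult)
  qed
  \<comment> \<open>The factor \<open>1\<close> gives the first term the shape that \<open>z\<close>
    expects.\<close>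
  have "anticomm (pivot (i + 1)) (pivot (i + 2)) = - (lmult (gx (i + 1) * 1) * pivot (i + 3) :: 'a grend) +
      lmult (gx (i + 1) * gx (i + 2)) * anticomm (pivot (i + 2)) (pivot (i + 3))"
    using step[of "i + 1"] by (subst anticomm_commute) (simp add: eval_nat_numeral)
  then have "lmult (gx i * gx (i + 1)) * anticomm (pivot (i + 1)) (pivot (i + 2)) = (0 :: 'a grend)"
    by (simp only: distrib_left mult_minus_right z minus_zero add_0)
  then show ?thesis
    using step[of i] by (simp add: anticomm_commute)
qed

text \<open>\<open>v_m\<close> anticommutes with \<open>gderiv i\<close> and kills
  \<open>x_i x_(i+1)\<close>, so these two letters come out in front. This is the induction step for
  both closed formulas.\<close>

lemma anticomm_pivot_add_2:
  assumes "i + 2 \<le> m"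
  shows "anticomm (pivot i) (pivot m) = lmult (gx i * gx (i + 1)) * anticomm (pivot (i + 2)) (pivot m)"
proof -
  have "app (pivot m) (gx i * gx (i + 1)) = (0 :: 'a grassmann)"
    using assms by (intro pivot_below_eq_0[of _ m] grassmann_below_mult grassmann_below_gx) auto
  then show ?thesis using assms
    by (subst anticomm_commute, subst (2) pivot_rec')
      (simp add: anticomm_add_right anticomm_lmult[OF odd_superderivation_pivot ginvol_even_pair]
        anticomm_gderiv_pivot anticomm_commute[of _ "gderiv i"] anticomm_commute[of "pivot m"])
qed

lemma monom_interval_step:
  assumes "finite A" "\<forall>a\<in>A. i + 2 \<le> a"
  shows "gx i * gx (i + 1) * monom A = monom ({i, i + 1} \<union> A)"
proof -
  have "monom (insert (i + 1) A) = gx (i + 1) * (monom A :: 'a grassmann)"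
    using assms by (intro monom_insert) auto
  moreover have "monom (insert i (insert (i + 1) A)) = gx i * (monom (insert (i + 1) A) :: 'a grassmann)"
    using assms by (intro monom_insert) auto
  ultimately show ?thesis by (simp add: mult.assoc)
qed

text \<open>Induction on the distance in steps of two, starting from neighbouring pivots.\<close>

lemma anticomm_pivot_odd:
  "anticomm (pivot i) (pivot (i + 2 * k + 1)) =
    - (lmult (monom {i..<i + 2 * k + 1}) * pivot (i + 2 * k + 2))"
proof (induction k arbitrary: i)
  case 0
  have "{i..<i + 1} = {i}" by auto
  then show ?case using anticomm_pivot_Suc[of i] by (simp add: gx_def)
next
  case (Suc k)
  have "{i..<i + 2 * Suc k + 1} = {i, i + 1} \<union> {i + 2..<i + 2 + 2 * k + 1}" by auto
  then have "monom {i..<i + 2 * Suc k + 1} =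
      gx i * gx (i + 1) * (monom {i + 2..<i + 2 + 2 * k + 1} :: 'a grassmann)"
    by (simp only:) (rule monom_interval_step[symmetric]; simp)
  then show ?case
    using anticomm_pivot_add_2[of i "i + 2 * Suc k + 1", where 'a = 'a] Suc.IH[of "i + 2"]
    by (simp add: lmult_mult mult.assoc)
qed

text \<open>The same induction, starting from \<open>[v_i, v_i] = 2 v_i v_i\<close>, which is where
  the factor \<open>2\<close> comes from.\<close>

lemma anticomm_pivot_even:
  "anticomm (pivot i) (pivot (i + 2 * k)) =
    escale 2 (lmult (monom ({i..<i + 2 * k} \<union> {i + 2 * k + 1})) * pivot (i + 2 * k + 2))"
proof (induction k arbitrary: i)
  case 0
  have "anticomm (pivot i) (pivot i) = escale (1 + 1) (pivot i * pivot i :: 'a grend)"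
    unfolding gend.scale_left_distrib by (simp add: anticomm_def)
  then show ?case unfolding pivot_square by (simp add: gx_def)
next
  case (Suc k)
  have "{i..<i + 2 * Suc k} \<union> {i + 2 * Suc k + 1} =
     {i, i + 1} \<union> ({i + 2..<i + 2 + 2 * k} \<union> {i + 2 + 2 * k + 1})" by auto
  then have "monom ({i..<i + 2 * Suc k} \<union> {i + 2 * Suc k + 1}) =
      gx i * gx (i + 1) * (monom ({i + 2..<i + 2 + 2 * k} \<union> {i + 2 + 2 * k + 1}) :: 'a grassmann)"
    by (simp only:) (rule monom_interval_step[symmetric]; auto)
  then show ?case
    using anticomm_pivot_add_2[of i "i + 2 * Suc k", where 'a = 'a] Suc.IH[of "i + 2"]
    by (simp add: lmult_mult mult.assoc escale_mult_right)
qed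

text \<open>In both parities, \<open>[v\<^sub>i, v\<^sub>m]\<close> is divisible by \<open>x\<^sub>i \<cdots> x\<^bsub>m-1\<^esub>\<close>.\<close>

lemma lmult_anticomm_pivot_eq_0:
  assumes f: "\<And>A. coef f A \<noteq> 0 \<Longrightarrow> A \<inter> {i..<m} \<noteq> {}" and "i \<le> m"
  shows "lmult f * anticomm (pivot i) (pivot m) = 0"
proof -
  have z: "lmult f * (lmult (monom B) * D) = 0" if "{i..<m} \<subseteq> B" for B and D :: "'a grend"
  proof -
    have "f * monom B = 0"
    proof (rule grassmann_eqI, rule ccontr)
      fix C assume "coef (f * monom B) C \<noteq> coef 0 C"
      then have "coef (f * monom B) C \<noteq> 0" by simp
      then obtain A A' where "coef f A \<noteq> 0" "coef (monom B :: 'a grassmann) A' \<noteq> 0" "A \<inter> A' = {}"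
        by (rule coef_mult_nonzeroE)
      then show False using f that by (fastforce simp: monom.rep_eq split: if_splits)
    qed
    then show ?thesis by (simp flip: mult.assoc lmult_mult)
  qed
  show ?thesis
  proof (cases "even (m - i)")
    case True
    then obtain k where "m = i + 2 * k" using \<open>i \<le> m\<close> by (metis dvdE le_add_diff_inverse)
    then show ?thesis
      using z by (simp only: anticomm_pivot_even escale_mult_right) (simp add: subset_insertI)
  next
    case False
    then obtain k where "m = i + 2 * k + 1"
      using \<open>i \<le> m\<close> by (metis oddE le_add_diff_inverse add.assoc)
    then show ?thesis
      using z by (simp only: anticomm_pivot_odd mult_minus_right) simp
  qed
qed

section \<open>The span of the admissible monomials \<open>x\<^sub>A v\<^sub>n\<close>\<close>

definition pivot_monom :: "nat set \<Rightarrow> nat \<Rightarrow> 'k::field grend" where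
  "pivot_monom A n = lmult (monom A) * pivot n"

lemma pivot_monom_empty [simp]: "pivot_monom {} n = pivot n"
  by (simp add: pivot_monom_def monom_empty)

lemma pivot_square_monom: "pivot n * pivot n = pivot_monom {n + 1} (n + 2)"
  by (simp add: pivot_square pivot_monom_def gx_def)

lemma coef_monom_nonzero: "coef (monom A) B \<noteq> 0 \<longleftrightarrow> finite A \<and> B = A"
  by (auto simp: monom.rep_eq)

lemma ghom_monom: "ghom (card A) (monom A)"
  by (simp add: ghom_def coef_monom_nonzero)

lemma ehom_pivot_monom: "ehom (card A + 1) (pivot_monom A n)"
  unfolding pivot_monom_def by (intro ehom_mult lmult_ehom ghom_monom ehom_pivot)

lemma lmult_sum: "lmult (\<Sum>i\<in>S. f i) = (\<Sum>i\<in>S. lmult (f i))"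
  by (induction S rule: infinite_finite_induct) (simp_all add: lmult_add)

lemma lmult_pivot_expand:
  "lmult f * pivot n = (\<Sum>A | coef f A \<noteq> 0. escale (coef f A) (pivot_monom A n))"
  by (subst grassmann_expand)
    (simp add: lmult_sum lmult_gscale sum_distrib_right escale_mult_left pivot_monom_def)

lemma lmult_monom_pivot_monom:
  assumes "finite A" "finite B" "A \<inter> B = {}"
  shows "lmult (monom A) * pivot_monom B n = escale ((- 1) ^ inversions A B) (pivot_monom (A \<union> B) n)"
  unfolding pivot_monom_def mult.assoc[symmetric] lmult_mult[symmetric] monom_mult[OF assms]
  by (simp add: lmult_gscale escale_mult_left)

text \<open>The tail \<open>x_i x_(i+1) v_(i+2)\<close> contributes nothing: \<open>v_(i+2)\<close>
  leaves the letter \<open>i\<close> in the monomial, and \<open>x_i\<close> then annihilates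
  it.\<close>

lemma app_pivot_monom:
  assumes "i \<in> A"
  shows "app (pivot i) (monom A) =
    gscale ((- 1) ^ card {a \<in> A. a < i}) (monom (A - {i}) :: 'k::field grassmann)"
proof -
  have "gx i * (gx (i + 1) * app (pivot (i + 2)) (monom A)) = (0 :: 'k grassmann)"
  proof (rule grassmann_eqI, rule ccontr)
    fix C
    assume "coef (gx i * (gx (i + 1) * app (pivot (i + 2)) (monom A))) C \<noteq> coef (0 :: 'k grassmann) C"
    then have "coef (gx i * (gx (i + 1) * app (pivot (i + 2)) (monom A)) :: 'k grassmann) C \<noteq> 0" by simp
    then obtain B where B: "i \<notin> B" "coef (gx (i + 1) * app (pivot (i + 2)) (monom A) :: 'k grassmann) B \<noteq> 0"
      by (rule coef_mult_nonzeroE) (auto simp: coef_gx split: if_splits)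
    from B(2) obtain D where D: "D \<subseteq> B" "coef (app (pivot (i + 2)) (monom A) :: 'k grassmann) D \<noteq> 0"
      by (rule coef_mult_nonzeroE) auto
    from D(2) have "i \<in> D"
      by (rule coef_pivot_nonzeroE) (use assms in \<open>auto simp: coef_monom_nonzero\<close>)
    then show False using B(1) D(1) by blast
  qed
  then have "app (pivot i) (monom A) = (app (gderiv i) (monom A) :: 'k grassmann)"
    using arg_cong[OF pivot_rec'[of i], of "\<lambda>D. app D (monom A) :: 'k grassmann"]
      by (simp add: mult.assoc)
  also have "\<dots> = gscale ((- 1) ^ card {a \<in> A. a < i}) (monom (A - {i}))"
  proof (rule grassmann_eqI)
    fix C :: "nat set"
    have "insert i C = A \<longleftrightarrow> C = A - {i}" if "i \<notin> C" using that assms by blast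
    moreover have "{a \<in> A - {i}. a < i} = {a \<in> A. a < i}" by auto
    ultimately show "coef (app (gderiv i) (monom A)) C =
      coef (gscale ((- 1) ^ card {a \<in> A. a < i}) (monom (A - {i})) :: 'k grassmann) C"
      by (auto simp: coef_gderiv monom.rep_eq)
  qed
  finally show ?thesis .
qed

text \<open>The term with \<open>[v_i, v_m]\<close> vanishes, since that bracket is divisible by
  \<open>x_i\<close> and \<open>i \<in> A\<close>.\<close>

lemma sbracket_pivot_monom_strip:
  assumes "i \<in> A" "i < m"
  shows "sbracket (pivot i) (pivot_monom A m) =
    escale ((- 1) ^ card {a \<in> A. a < i}) (pivot_monom (A - {i}) m :: 'k::field grend)"
proof -
  have "lmult (ginvol (monom A)) * anticomm (pivot i) (pivot m) = (0 :: 'k grend)"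
    using assms by (intro lmult_anticomm_pivot_eq_0) (auto simp: coef_ginvol coef_monom_nonzero)
  then show ?thesis
    unfolding pivot_monom_def sbracket_odd_lmult[OF odd_superderivation_pivot ehom_pivot]
      app_pivot_monom[OF assms(1)]
    by (simp add: lmult_gscale escale_mult_left)
qed

text \<open>\<open>v_i\<close> kills the monomial of \<open>A\<close>, whose letters lie below
  \<open>i\<close>; what is left is the closed formula for \<open>[v_i, v_m]\<close>.\<close>

lemma sbracket_pivot_monom_odd:
  assumes "A \<subseteq> {..<i}"
  obtains c where "c \<noteq> 0" "sbracket (pivot i) (pivot_monom A (i + 2 * k + 1)) =
    escale c (pivot_monom (A \<union> {i..<i + 2 * k + 1}) (i + 2 * k + 2) :: 'k::field grend)"
proof
  have A: "finite A" "A \<inter> {i..<i + 2 * k + 1} = {}" using assms by (auto intro: finite_subset)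
  have "app (pivot i) (monom A) = (0 :: 'k grassmann)"
    using assms by (intro pivot_below_eq_0[of _ i] grassmann_below_monom) auto
  then have "sbracket (pivot i) (pivot_monom A (i + 2 * k + 1)) =
      escale ((- 1) ^ card A) (- (lmult (monom A) * pivot_monom {i..<i + 2 * k + 1} (i + 2 * k + 2) :: 'k grend))"
    unfolding pivot_monom_def sbracket_odd_lmult[OF odd_superderivation_pivot ehom_pivot]
      anticomm_pivot_odd ginvol_monom
    by (simp only: lmult_gscale escale_mult_left mult_minus_right lmult_zero mult_zero_left add_0 gend.scale_minus_right)
  also have "\<dots> = escale (- ((- 1) ^ card A * (- 1) ^ inversions A {i..<i + 2 * k + 1}))
     (pivot_monom (A \<union> {i..<i + 2 * k + 1}) (i + 2 * k + 2))"
    unfolding lmult_monom_pivot_monom[OF A(1) finite_atLeastLessThan A(2)] by simp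
  finally show "sbracket (pivot i) (pivot_monom A (i + 2 * k + 1)) =
    escale (- ((- 1) ^ card A * (- 1) ^ inversions A {i..<i + 2 * k + 1}))
     (pivot_monom (A \<union> {i..<i + 2 * k + 1}) (i + 2 * k + 2) :: 'k grend)" .
qed simp

text \<open>The factor \<open>2\<close> is kept apart from the nonzero \<open>c\<close> because it
  vanishes in characteristic 2.\<close>

lemma sbracket_pivot_monom_even:
  assumes "A \<subseteq> {..<i}"
  obtains c where "c \<noteq> 0" "sbracket (pivot i) (pivot_monom A (i + 2 * k)) =
    escale (2 * c) (pivot_monom (A \<union> ({i..<i + 2 * k} \<union> {i + 2 * k + 1})) (i + 2 * k + 2) :: 'k::field grend)"
proof
  have A: "finite A" "A \<inter> ({i..<i + 2 * k} \<union> {i + 2 * k + 1}) = {}"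
    and F: "finite ({i..<i + 2 * k} \<union> {i + 2 * k + 1})"
    using assms by (auto intro: finite_subset)
  have "app (pivot i) (monom A) = (0 :: 'k grassmann)"
    using assms by (intro pivot_below_eq_0[of _ i] grassmann_below_monom) auto
  then have "sbracket (pivot i) (pivot_monom A (i + 2 * k)) =
      escale ((- 1) ^ card A) (escale 2
        (lmult (monom A) * pivot_monom ({i..<i + 2 * k} \<union> {i + 2 * k + 1}) (i + 2 * k + 2) :: 'k grend))"
    unfolding pivot_monom_def sbracket_odd_lmult[OF odd_superderivation_pivot ehom_pivot]
      anticomm_pivot_even ginvol_monom
    by (simp only: lmult_gscale escale_mult_left escale_mult_right lmult_zero mult_zero_left add_0)
      (rule gend.scale_left_commute)
  also have "\<dots> = escale (2 * ((- 1) ^ card A * (- 1) ^ inversions A ({i..<i + 2 * k} \<union> {i + 2 * k + 1})))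
     (pivot_monom (A \<union> ({i..<i + 2 * k} \<union> {i + 2 * k + 1})) (i + 2 * k + 2))"
    unfolding lmult_monom_pivot_monom[OF A(1) F A(2)] by (simp add: mult_ac)
  finally show "sbracket (pivot i) (pivot_monom A (i + 2 * k)) =
    escale (2 * ((- 1) ^ card A * (- 1) ^ inversions A ({i..<i + 2 * k} \<union> {i + 2 * k + 1})))
     (pivot_monom (A \<union> ({i..<i + 2 * k} \<union> {i + 2 * k + 1})) (i + 2 * k + 2) :: 'k grend)" .
qed simp

lemma two_eq_0_iff_CHAR: "(2 :: 'k::field) = 0 \<longleftrightarrow> CHAR('k) = 2"
proof
  assume "(2 :: 'k) = 0"
  then have "CHAR('k) dvd 2" using of_nat_eq_0_iff_char_dvd[of 2, where 'a = 'k] by simp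
  moreover have "CHAR('k) \<noteq> 1" using of_nat_eq_0_iff_char_dvd[of 1, where 'a = 'k] by auto
  moreover have "d = 1 \<or> d = 2" if "d dvd 2" for d :: nat
    using dvd_imp_le[OF that] that by (cases "d = 0") auto
  ultimately show "CHAR('k) = 2" by blast
next
  assume "CHAR('k) = 2"
  then show "(2 :: 'k) = 0" using of_nat_eq_0_iff_char_dvd[of 2, where 'a = 'k] by simp
qed

section \<open>Admissible monomials: closure under brackets and squares\<close>

text \<open>Writing \<open>n = j + 2\<close> avoids truncated subtraction and imposes no condition
  on the top letters for \<open>n < 2\<close>. A top letter \<open>n - 1\<close> arises from
  brackets at even distance, which skip the letter \<open>n - 2\<close> and vanish in characteristic
  2, or from the squares \<open>v_j v_j = x_(j+1) v_(j+2)\<close>.\<close>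

definition admissible :: "nat \<Rightarrow> nat \<Rightarrow> nat set \<Rightarrow> bool" where
  "admissible p n A \<longleftrightarrow> A \<subseteq> {..<n} \<and>
     (\<forall>j. n = j + 2 \<longrightarrow> j + 1 \<in> A \<longrightarrow> j \<notin> A \<and> (p = 2 \<longrightarrow> A = {j + 1}))"

definition admissible_span :: "'k::field grend set" where
  "admissible_span = gend.span {pivot_monom A n |A n. admissible CHAR('k) n A}"

lemma subspace_admissible_span: "gend.subspace admissible_span"
  unfolding admissible_span_def by (rule gend.subspace_span)

lemma pivot_monom_in_admissible_span:
  "admissible CHAR('k) n A \<Longrightarrow> (pivot_monom A n :: 'k::field grend) \<in> admissible_span"
  unfolding admissible_span_def by (rule gend.span_base) blast

lemma lmult_pivot_in_admissible_span:
  assumes "\<And>A. coef f A \<noteq> 0 \<Longrightarrow> admissible CHAR('k) n A"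
  shows "lmult (f :: 'k::field grassmann) * pivot n \<in> admissible_span"
  unfolding lmult_pivot_expand using assms subspace_admissible_span
  by (intro gend.subspace_sum gend.subspace_scale pivot_monom_in_admissible_span) auto

text \<open>The condition \<open>app w f = 0\<close> removes one of the two Leibniz terms; it holds
  for \<open>f\<close> in letters below \<open>m\<close> and \<open>w = v_m\<close>. Supercommuting
  \<open>g\<close> past \<open>f\<close> matches the signs of the other products.\<close>

lemma sbracket_lmult_lmult:
  assumes v: "odd_superderivation v" and w: "odd_superderivation w"
    and f: "ghom p f" and g: "ghom q g" and 0: "app w f = 0"
  shows "sbracket (lmult f * v) (lmult g * w) =
    lmult (f * app v g) * w + lmult (f * ginvol g) * anticomm v w"
proof -
  have vw: "ehom 1 v" "ehom 1 w" using v w unfolding odd_superderivation_def by auto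
  then have e: "ehom (p + 1) (lmult f * v)" "ehom (q + 1) (lmult g * w)"
    using ehom_mult[OF lmult_ehom[OF f] vw(1)] ehom_mult[OF lmult_ehom[OF g] vw(2)] by simp_all
  have "lmult f * v * (lmult g * w) = lmult f * (v * lmult g) * w" by (simp only: mult.assoc)
  also have "\<dots> = lmult (f * app v g) * w + lmult (f * ginvol g) * (v * w)"
    unfolding odd_superderivation_lmult[OF v] by (simp add: lmult_mult algebra_simps)
  finally have 1: "lmult f * v * (lmult g * w) =
    lmult (f * app v g) * w + lmult (f * ginvol g) * (v * w)" .
  have "lmult g * w * (lmult f * v) = lmult g * (w * lmult f) * v" by (simp only: mult.assoc)
  also have "\<dots> = lmult (g * ginvol f) * (w * v)"
    unfolding odd_superderivation_lmult[OF w] 0 by (simp add: lmult_mult algebra_simps)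
  also have "g * ginvol f = gscale ((- 1) ^ (p + p * q)) (f * g)"
    unfolding ginvol_ghom[OF f] gscale_mult_right gmult_supercommute[OF g f]
    by (simp add: power_add mult_ac)
  finally have 2: "lmult g * w * (lmult f * v) =
    escale ((- 1) ^ (p + p * q)) (lmult (f * g) * (w * v))"
    by (simp add: lmult_gscale escale_mult_left)
  show ?thesis
    unfolding sbracket_ehom[OF e] 1 2 minus_one_power_mult_escale anticomm_def
      ginvol_ghom[OF g] gscale_mult_right lmult_gscale escale_mult_left
    by (cases "even p"; cases "even q"; simp add: distrib_left)
qed

text \<open>In the first summand a top letter can only be inherited from \<open>B\<close>. The
  second summand ends in \<open>v_(m+1)\<close> without the letter \<open>m\<close>, or in
  \<open>v_(m+2)\<close> without the letter \<open>m\<close>.\<close>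

lemma pivot_monom_bracket_in_admissible_span:
  assumes A: "admissible CHAR('k) n A" and B: "admissible CHAR('k) m B" and "n \<le> m"
  shows "sbracket (pivot_monom A n) (pivot_monom B m) \<in> (admissible_span :: 'k::field grend set)"
proof -
  have AB: "A \<subseteq> {..<n}" "B \<subseteq> {..<m}" using A B unfolding admissible_def by auto
  let ?f = "monom A :: 'k grassmann" and ?g = "monom B :: 'k grassmann"
  have "app (pivot m) ?f = 0"
    using AB(1) \<open>n \<le> m\<close> by (intro pivot_below_eq_0[of _ n] grassmann_below_monom)
  then have eq: "sbracket (pivot_monom A n) (pivot_monom B m) =
      lmult (?f * app (pivot n) ?g) * pivot m + lmult (?f * ginvol ?g) * anticomm (pivot n) (pivot m)"
    unfolding pivot_monom_def
    by (rule sbracket_lmult_lmult[OF odd_superderivation_pivot odd_superderivation_pivot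
          ghom_monom ghom_monom])
  have "admissible CHAR('k) m C" if "coef (?f * app (pivot n) ?g) C \<noteq> 0" for C
  proof -
    from that obtain A' D where "A' = A" "C = A' \<union> D" "coef (app (pivot n) ?g) D \<noteq> 0"
      by (rule coef_mult_nonzeroE) (auto simp: coef_monom_nonzero)
    moreover from this obtain j where j: "j \<in> B" "n \<le> j" "D = {n..<j} \<union> (B - {j})"
      by (elim coef_pivot_nonzeroE) (auto simp: coef_monom_nonzero)
    ultimately have C: "C = A \<union> {n..<j} \<union> (B - {j})" by auto
    have "j < m" using j AB by auto
    show ?thesis
      unfolding admissible_def
    proof (intro conjI allI impI)
      show "C \<subseteq> {..<m}" using C AB \<open>n \<le> m\<close> \<open>j < m\<close> by auto
    next
      fix i assume i: "m = i + 2" "i + 1 \<in> C"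
      then have *: "i + 1 \<in> B" "j \<noteq> i + 1" using C AB j \<open>j < m\<close> \<open>n \<le> m\<close> by auto
      then have "i \<notin> B" using B i(1) unfolding admissible_def by blast
      then have "j < i" using j \<open>j < m\<close> * i(1) by (metis add_2_eq_Suc' less_SucE Suc_eq_plus1)
      then show "i \<notin> C" using \<open>i \<notin> B\<close> C AB j by auto
      \<comment> \<open>Vacuous: admissibility would give \<open>B = {i + 1}\<close>, but
        \<open>j \<in> B\<close> and \<open>j \<noteq> i + 1\<close>.\<close>
      show "C = {i + 1}" if "CHAR('k) = 2"
        using B i(1) that * j(1) unfolding admissible_def by blast
    qed
  qed
  then have 1: "lmult (?f * app (pivot n) ?g) * pivot m \<in> admissible_span"
    by (rule lmult_pivot_in_admissible_span)
  have fg: "C \<subseteq> {..<m}" if "coef (?f * ginvol ?g) C \<noteq> 0" for C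
    using that by (rule coef_mult_nonzeroE)
      (use AB \<open>n \<le> m\<close> in \<open>auto simp: coef_ginvol coef_monom_nonzero\<close>)
  have 2: "lmult (?f * ginvol ?g) * anticomm (pivot n) (pivot m) \<in> admissible_span"
  proof (cases "even (m - n)")
    case True
    then obtain k where k: "m = n + 2 * k" using \<open>n \<le> m\<close> by (metis dvdE le_add_diff_inverse)
    have "lmult (?f * ginvol ?g * monom ({n..<m} \<union> {m + 1})) * pivot (m + 2) \<in> (admissible_span :: 'k grend set)"
      if "CHAR('k) \<noteq> 2"
    proof (rule lmult_pivot_in_admissible_span)
      fix C assume "coef (?f * ginvol ?g * monom ({n..<m} \<union> {m + 1})) C \<noteq> 0"
      then have "C \<subseteq> {..<m} \<union> {m + 1}"
        by (rule coef_mult_nonzeroE) (use fg in \<open>auto simp: coef_monom_nonzero\<close>)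
      then show "admissible CHAR('k) (m + 2) C"
        using that unfolding admissible_def by force
    qed
    \<comment> \<open>In characteristic 2 the factor 2 removes this term, whose monomials with top
      letter \<open>m + 1\<close> may contain further letters.\<close>
    moreover have "escale 2 D = 0" if "CHAR('k) = 2" for D :: "'k grend"
      using that two_eq_0_iff_CHAR[where 'k = 'k] by simp
    ultimately show ?thesis
      unfolding k anticomm_pivot_even escale_mult_right mult.assoc[symmetric] lmult_mult[symmetric]
      using subspace_admissible_span gend.subspace_scale gend.subspace_0 by (metis (no_types))
  next
    case False
    then obtain k where k: "m = n + 2 * k + 1"
      using \<open>n \<le> m\<close> by (metis oddE le_add_diff_inverse add.assoc)
    have "lmult (?f * ginvol ?g * monom {n..<m}) * pivot (m + 1) \<in> (admissible_span :: 'k grend set)"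
    proof (rule lmult_pivot_in_admissible_span)
      fix C assume "coef (?f * ginvol ?g * monom {n..<m}) C \<noteq> 0"
      then have "C \<subseteq> {..<m}"
        by (rule coef_mult_nonzeroE) (use fg in \<open>auto simp: coef_monom_nonzero\<close>)
      then show "admissible CHAR('k) (m + 1) C"
        unfolding admissible_def by force
    qed
    then show ?thesis
      unfolding k anticomm_pivot_odd mult_minus_right mult.assoc[symmetric] lmult_mult[symmetric]
      using subspace_admissible_span gend.subspace_neg by auto
  qed
  show ?thesis unfolding eq using 1 2 subspace_admissible_span by (intro gend.subspace_add)
qed

text \<open>Bilinearity reduces to generators, and supersymmetry of the bracket to the order
  \<open>n \<le> m\<close>.\<close>

lemma sbracket_in_admissible_span:
  assumes "D \<in> admissible_span" "E \<in> admissible_span"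
  shows "sbracket D E \<in> (admissible_span :: 'k::field grend set)"
proof -
  note sub = subspace_admissible_span
  have gens: "sbracket (pivot_monom A n) (pivot_monom B m) \<in> (admissible_span :: 'k grend set)"
    if "admissible CHAR('k) n A" "admissible CHAR('k) m B" for A n B m
  proof (cases "n \<le> m")
    case True
    then show ?thesis using that by (intro pivot_monom_bracket_in_admissible_span)
  next
    case False
    then have "sbracket (pivot_monom B m) (pivot_monom A n) \<in> (admissible_span :: 'k grend set)"
      using that by (intro pivot_monom_bracket_in_admissible_span) auto
    then show ?thesis
      unfolding sbracket_commute[OF ehom_pivot_monom[of B m] ehom_pivot_monom[of A n]]
      by (rule gend.subspace_scale[OF sub])
  qed
  have left: "sbracket D (pivot_monom B m) \<in> (admissible_span :: 'k grend set)"
    if "admissible CHAR('k) m B" for B m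
    using assms(1)
    unfolding admissible_span_def
  proof (induction D rule: gend.span_induct_alt)
    case base
    then show ?case by (simp add: gend.span_zero)
  next
    case (step c x y)
    then show ?case
      using gens[OF _ that]
      by (auto simp: sbracket_add_left sbracket_escale_left admissible_span_def
          intro!: gend.span_add gend.span_scale)
  qed
  show ?thesis
    using assms(2) unfolding admissible_span_def
  proof (induction E rule: gend.span_induct_alt)
    case base
    then show ?case by (simp add: gend.span_zero)
  next
    case (step c x y)
    then show ?case
      using left
      by (auto simp: sbracket_add_right sbracket_escale_right admissible_span_def
          intro!: gend.span_add gend.span_scale)
  qed
qed

lemma ehom_zero: "ehom p 0"
  and ehom_add: "ehom p D \<Longrightarrow> ehom p E \<Longrightarrow> ehom p (D + E)"
  and ehom_escale: "ehom p D \<Longrightarrow> ehom p (escale c D)"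
  for D E :: "'k::field grend"
proof -
  show "ehom p 0" by (simp add: ehom_def ghom_def)
  show "ehom p (D + E)" if "ehom p D" "ehom p E"
    unfolding ehom_def ghom_def
  proof (intro allI impI)
    fix q :: nat and A and f :: "'k grassmann"
    assume f: "\<forall>A. coef f A \<noteq> 0 \<longrightarrow> even (card A) = even q" and A: "coef (app (D + E) f) A \<noteq> 0"
    then have "coef (app D f) A \<noteq> 0 \<or> coef (app E f) A \<noteq> 0" by auto
    then show "even (card A) = even (p + q)"
      using that f unfolding ehom_def ghom_def by blast
  qed
  show "ehom p (escale c D)" if "ehom p D"
    using that unfolding ehom_def ghom_def by (simp add: escale.rep_eq)
qed

text \<open>\<open>v_n\<close> kills the monomial of \<open>A\<close>, so the square contains that
  monomial twice.\<close>

lemma pivot_monom_square: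
  assumes "A \<subseteq> {..<n}" "A \<noteq> {}"
  shows "pivot_monom A n * pivot_monom A n = (0 :: 'k::field grend)"
proof -
  have "app (pivot n) (monom A) = (0 :: 'k grassmann)"
    using assms by (intro pivot_below_eq_0[of _ n] grassmann_below_monom) auto
  then have "pivot n * lmult (monom A) = lmult (ginvol (monom A)) * (pivot n :: 'k grend)"
    using odd_superderivation_lmult[OF odd_superderivation_pivot, of n "monom A :: 'k grassmann"] by simp
  then have "pivot_monom A n * pivot_monom A n =
      lmult (monom A) * (lmult (ginvol (monom A)) * pivot n) * (pivot n :: 'k grend)"
    unfolding pivot_monom_def by (metis mult.assoc)
  also have "\<dots> = lmult (monom A * ginvol (monom A)) * (pivot n * pivot n)"
    by (simp only: lmult_mult mult.assoc)
  also have "monom A * ginvol (monom A) = (0 :: 'k grassmann)"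
    using monom_mult_eq_0[of A A, where 'a = 'k] assms by (simp add: ginvol_monom gscale_mult_right)
  finally show ?thesis by simp
qed

lemma admissible_empty: "admissible p n {}"
  by (simp add: admissible_def)

text \<open>Squaring is not additive, so it is handled by induction over the span \<open>G\<close>
  of the odd generators, where the mixed terms form a bracket. An odd element lies in this span
  because it equals its own odd component.\<close>

lemma lie_subsuperalgebra_admissible_span:
  "lie_subsuperalgebra (admissible_span :: 'k::field grend set)"
proof -
  note sub = subspace_admissible_span
  define G where "G = ({pivot_monom A n |A n. admissible CHAR('k) n A \<and> odd (card A + 1)} :: 'k grend set)"
  have comp: "ecomp p D \<in> admissible_span \<and> ecomp 1 D \<in> gend.span G"
    if "D \<in> admissible_span" for p and D :: "'k grend"
    using that unfolding admissible_span_def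
  proof (induction D rule: gend.span_induct_alt)
    case base
    then show ?case by (simp add: gend.span_zero)
  next
    case (step c x y)
    then obtain A n where x: "x = pivot_monom A n" "admissible CHAR('k) n A" by blast
    have "ecomp 1 x \<in> gend.span G" "ecomp p x \<in> admissible_span"
      unfolding x(1) ecomp_ehom[OF ehom_pivot_monom]
      using x pivot_monom_in_admissible_span[OF x(2)] gend.subspace_0[OF sub]
      by (auto simp: G_def gend.span_zero intro!: gend.span_base)
    then show ?case
      using step by (auto simp: ecomp_add ecomp_escale admissible_span_def
          intro!: gend.span_add gend.span_scale)
  qed
  have square: "ehom 1 D \<and> D \<in> admissible_span \<and> D * D \<in> admissible_span" if "D \<in> gend.span G" for D
    using that
  proof (induction D rule: gend.span_induct_alt)
    case base
    then show ?case using gend.subspace_0[OF sub] by (simp add: ehom_zero)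
  next
    case (step c x y)
    then obtain A n where x: "x = pivot_monom A n" "admissible CHAR('k) n A" "odd (card A + 1)"
      unfolding G_def by blast
    have 1: "ehom 1 x" unfolding x(1) using ehom_pivot_monom[of A n, where 'a = 'k] x(3)
      unfolding ehom_def ghom_def by simp
    have 2: "x \<in> admissible_span" unfolding x(1) by (rule pivot_monom_in_admissible_span[OF x(2)])
    have 3: "x * x \<in> admissible_span"
    proof (cases "A = {}")
      case True
      have "x * x = pivot_monom {n + 1} (n + 2)"
        unfolding x(1) True by (simp only: pivot_monom_empty pivot_square_monom)
      then show ?thesis by (simp only:) (rule pivot_monom_in_admissible_span, simp add: admissible_def)
    next
      case False
      then show ?thesis
        using x(1,2) pivot_monom_square[of A n, where 'k = 'k] gend.subspace_0[OF sub]
        unfolding admissible_def by simp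
    qed
    have 4: "sbracket x y \<in> admissible_span" using 2 step.IH
      by (simp add: sbracket_in_admissible_span)
    have "sbracket x y = x * y + y * x"
      using sbracket_odd[OF 1] step.IH by (simp add: anticomm_def)
    then have "(escale c x + y) * (escale c x + y) =
        escale (c * c) (x * x) + escale c (sbracket x y) + y * y"
      by (simp add: distrib_left distrib_right escale_mult_left escale_mult_right gend.scale_right_distrib)
    then show ?case
      using 1 2 3 4 step.IH sub
      by (auto intro!: ehom_add ehom_escale gend.subspace_add gend.subspace_scale)
  qed
  show ?thesis
    unfolding lie_subsuperalgebra_def graded_subspace_def power2_eq_square
    using sub comp sbracket_in_admissible_span square
    by (metis ecomp_ehom)
qed

section \<open>The algebra between the pivots and the admissible span\<close>

lemma pivot_superalgebra_subset: "pivot_superalgebra \<subseteq> (admissible_span :: 'k::field grend set)"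
proof -
  have "pivot n \<in> (admissible_span :: 'k grend set)" for n
    using pivot_monom_in_admissible_span[OF admissible_empty, of n, where 'k = 'k] by simp
  then show ?thesis
    using lie_subsuperalgebra_admissible_span
      unfolding pivot_superalgebra_def lie_generated_def by blast
qed

lemma lie_subsuperalgebra_pivot_superalgebra: "lie_subsuperalgebra pivot_superalgebra"
  unfolding pivot_superalgebra_def by (rule lie_subsuperalgebra_lie_generated)

text \<open>The square is half of \<open>[v_n, v_n]\<close> if 2 is invertible, and a value of the
  quadratic mapping in characteristic 2. A general subspace \<open>S\<close> allows use for the
  algebra as well as for its ideals.\<close>

lemma pivot_square_in:
  assumes S: "gend.subspace S" "pivot n \<in> S"
    and br: "sbracket (pivot n) (pivot n) \<in> (S :: 'k::field grend set)"
    and sq: "CHAR('k) = 2 \<Longrightarrow> pivot n ^ 2 \<in> S"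
  shows "pivot_monom {n + 1} (n + 2) \<in> S"
proof -
  have "pivot_monom {n + 1} (n + 2) = (pivot n * pivot n :: 'k grend)"
    by (simp only: pivot_square_monom)
  moreover have "pivot n * pivot n = escale (1 / 2) (sbracket (pivot n) (pivot n) :: 'k grend)"
    if "CHAR('k) \<noteq> 2"
  proof -
    have "sbracket (pivot n) (pivot n) = escale (1 + 1) (pivot n * pivot n :: 'k grend)"
      unfolding sbracket_odd[OF ehom_pivot ehom_pivot] anticomm_def gend.scale_left_distrib by simp
    then show ?thesis using that two_eq_0_iff_CHAR[where 'k = 'k] by simp
  qed
  ultimately show ?thesis
    using S(1) br sq gend.subspace_scale by (cases "CHAR('k) = 2") (auto simp: power2_eq_square)
qed

lemma pivot_in_pivot_superalgebra: "pivot n \<in> (pivot_superalgebra :: 'k::field grend set)"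
proof -
  let ?R = "pivot_superalgebra :: 'k grend set"
  have R: "gend.subspace ?R" "\<And>D E. D \<in> ?R \<Longrightarrow> E \<in> ?R \<Longrightarrow> sbracket D E \<in> ?R"
    "\<And>D. CHAR('k) = 2 \<Longrightarrow> D \<in> ?R \<Longrightarrow> ehom 1 D \<Longrightarrow> D ^ 2 \<in> ?R"
    using lie_subsuperalgebra_pivot_superalgebra[where 'a = 'k]
    unfolding lie_subsuperalgebra_def graded_subspace_def by auto
  \<comment> \<open>Two neighbours are carried along: \<open>v_(n+1)\<close> strips the letter off
    the square \<open>x_(n+1) v_(n+2)\<close> of \<open>v_n\<close>.\<close>
  have "pivot n \<in> ?R \<and> pivot (n + 1) \<in> ?R"
  proof (induction n)
    case 0
    then show ?case unfolding pivot_superalgebra_def lie_generated_def by auto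
  next
    case (Suc n)
    then have "pivot_monom {n + 1} (n + 2) \<in> ?R"
      using R ehom_pivot by (intro pivot_square_in) auto
    then have "sbracket (pivot (n + 1)) (pivot_monom {n + 1} (n + 2)) \<in> ?R"
      using Suc R(2) by blast
    moreover have e: "{a. a = Suc n \<and> a < Suc n} = {}" by auto
    ultimately have "pivot (n + 2) \<in> ?R"
      using sbracket_pivot_monom_strip[of "n + 1" "{n + 1}" "n + 2", where 'k = 'k] e by simp
    then show ?case using Suc by simp
  qed
  then show ?thesis by blast
qed

section \<open>Ideals containing a pivot element\<close>

lemma app_diff: "app D (f - g) = app D f - app D g"
  using app_add[of D "f - g" g] by (simp add: algebra_simps)

lemma grassmann_below_0_const:
  "g \<in> grassmann_below 0 \<Longrightarrow> g = gscale (coef g {}) (1 :: 'a::field grassmann)"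
  by (rule grassmann_eqI) (auto dest: grassmann_belowD)

lemma lmult_gx_anticomm_pivot_eq_0:
  assumes "i \<le> j" "j < m"
  shows "lmult (f * gx j * g) * anticomm (pivot i) (pivot m) = (0 :: 'a::field grend)"
proof (rule lmult_anticomm_pivot_eq_0)
  fix A assume "coef (f * gx j * g) A \<noteq> 0"
  then obtain B where "B \<subseteq> A" "coef (f * gx j) B \<noteq> 0" by (rule coef_mult_nonzeroE) auto
  moreover from this obtain B' where "B' \<subseteq> B" "coef (gx j :: 'a grassmann) B' \<noteq> 0"
    by (elim coef_mult_nonzeroE) auto
  ultimately have "j \<in> A" by (auto simp: coef_gx split: if_splits)
  then show "A \<inter> {i..<m} \<noteq> {}" using assms by auto
qed (use assms in simp)

context
  fixes J :: "'k::field grend set"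
  assumes J: "lie_ideal J pivot_superalgebra"
begin

lemma ideal_subspace: "gend.subspace J"
  using J unfolding lie_ideal_def by blast

lemma sbracket_pivot_in: "D \<in> J \<Longrightarrow> sbracket (pivot i) D \<in> J"
  using J pivot_in_pivot_superalgebra unfolding lie_ideal_def by blast

lemma escale_in_iff: "c \<noteq> 0 \<Longrightarrow> escale c D \<in> J \<longleftrightarrow> D \<in> J"
  using gend.subspace_scale[OF ideal_subspace, of D c]
    gend.subspace_scale[OF ideal_subspace, of "escale c D" "1 / c"] by auto

lemma pivot_monom_strip:
  assumes "pivot_monom A m \<in> J" "i \<in> A" "i < m"
  shows "pivot_monom (A - {i}) m \<in> J"
proof -
  have "escale ((- 1) ^ card {a \<in> A. a < i}) (pivot_monom (A - {i}) m) \<in> J"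
    using sbracket_pivot_in[OF assms(1), of i]
    unfolding sbracket_pivot_monom_strip[OF assms(2,3)] .
  then show ?thesis by (subst (asm) escale_in_iff) simp_all
qed

text \<open>The letters of \<open>B - A\<close> are stripped one after the other.\<close>

lemma pivot_monom_subset:
  assumes "pivot_monom B m \<in> J" "B \<subseteq> {..<m}" "A \<subseteq> B"
  shows "pivot_monom A m \<in> J"
proof -
  have "finite (B - A)" "B - A \<subseteq> B" using assms by (auto intro: finite_subset)
  then have "pivot_monom (B - (B - A)) m \<in> J"
  proof (induction rule: finite_subset_induct)
    case empty
    then show ?case using assms(1) by simp
  next
    case (insert i D)
    then have "pivot_monom (B - D - {i}) m \<in> J"
      using assms(2) by (intro pivot_monom_strip) auto
    then show ?case by (simp only: Diff_insert[of B i "D"])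
  qed
  then show ?thesis using assms(3) by (simp add: double_diff)
qed

lemma pivot_monom_extend_odd:
  assumes "pivot_monom A (i + 2 * k + 1) \<in> J" "A \<subseteq> {..<i}"
  shows "pivot_monom (A \<union> {i..<i + 2 * k + 1}) (i + 2 * k + 2) \<in> J"
proof -
  obtain c :: 'k where "c \<noteq> 0" "sbracket (pivot i) (pivot_monom A (i + 2 * k + 1)) =
    escale c (pivot_monom (A \<union> {i..<i + 2 * k + 1}) (i + 2 * k + 2))"
    using sbracket_pivot_monom_odd[OF assms(2), of k, where 'k = 'k] .
  then show ?thesis
    using sbracket_pivot_in[OF assms(1), of i] escale_in_iff by simp
qed

lemma pivot_monom_extend_even:
  assumes "pivot_monom A (i + 2 * k) \<in> J" "A \<subseteq> {..<i}" "CHAR('k) \<noteq> 2"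
  shows "pivot_monom (A \<union> ({i..<i + 2 * k} \<union> {i + 2 * k + 1})) (i + 2 * k + 2) \<in> J"
proof -
  obtain c :: 'k where "c \<noteq> 0" "sbracket (pivot i) (pivot_monom A (i + 2 * k)) =
    escale (2 * c) (pivot_monom (A \<union> ({i..<i + 2 * k} \<union> {i + 2 * k + 1})) (i + 2 * k + 2))"
    using sbracket_pivot_monom_even[OF assms(2), of k, where 'k = 'k] .
  moreover from this have "2 * c \<noteq> 0" using assms(3) two_eq_0_iff_CHAR[where 'k = 'k] by simp
  ultimately show ?thesis
    using sbracket_pivot_in[OF assms(1), of i] escale_in_iff by simp
qed

text \<open>\<open>[v_(m-1), v_m]\<close> is \<open>x_(m-1) v_(m+1)\<close> up to sign, and the
  letter can be stripped. The bound \<open>1 \<le> n\<close> ensures that \<open>v_(m-1)\<close>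
  exists.\<close>

lemma pivot_in_up:
  assumes "pivot n \<in> J" "1 \<le> n" "n \<le> m"
  shows "pivot m \<in> J"
  using assms(3)
proof (induction rule: dec_induct)
  case (step m)
  obtain i where i: "m = i + 1" using step assms
    by (metis Suc_eq_plus1 Suc_leD Suc_le_D One_nat_def le_trans)
  have "pivot_monom ({} \<union> {i..<i + 2 * 0 + 1}) (i + 2 * 0 + 2) \<in> J"
    using step.IH i by (intro pivot_monom_extend_odd) simp_all
  then have "pivot_monom {} (i + 2 * 0 + 2) \<in> J"
    by (rule pivot_monom_subset) auto
  then show ?case using i by simp
qed (rule assms(1))

text \<open>For odd \<open>k\<close>, \<open>[v_0, v_k]\<close> is
  \<open>x_0 ... x_(k-1) v_(k+1)\<close> up to sign. For even \<open>k\<close> the odd number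
  \<open>l = k - 1\<close> is used, which is still at least \<open>n\<close>, and a bracket with
  \<open>v_l\<close> appends the missing letter. Smaller sets follow by stripping.\<close>

lemma pivot_monom_initial_in:
  assumes n: "pivot n \<in> J" "1 \<le> n" and k: "n + 1 \<le> k" and A: "A \<subseteq> {..<k}"
  shows "pivot_monom A (k + 1) \<in> J"
proof -
  have odd: "pivot_monom {..<l} (l + 1) \<in> J" if l: "odd l" "n \<le> l" for l
  proof -
    obtain j where j: "l = 0 + 2 * j + 1" using l(1) by (metis add_0 oddE)
    have "pivot_monom ({} \<union> {0..<0 + 2 * j + 1}) (0 + 2 * j + 2) \<in> J"
      using pivot_in_up[OF n l(2)] j by (intro pivot_monom_extend_odd) simp_all
    then show ?thesis using j by (simp add: atLeast0LessThan)
  qed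
  have "pivot_monom {..<k} (k + 1) \<in> J"
  proof (cases "odd k")
    case True
    then show ?thesis using odd k by simp
  next
    case False
    then obtain l where l: "k = l + 1" "odd l" using k
      by (metis add.commute even_add even_plus_one_iff le_add_diff_inverse le_add2 le_trans odd_one)
    have "pivot_monom {..<l} (l + 2 * 0 + 1) \<in> J" using odd[of l] l k by simp
    then have "pivot_monom ({..<l} \<union> {l..<l + 2 * 0 + 1}) (l + 2 * 0 + 2) \<in> J"
      by (intro pivot_monom_extend_odd) simp_all
    moreover have "{..<l} \<union> {l..<l + 2 * 0 + 1} = {..<k}" using l by auto
    ultimately show ?thesis using l by simp
  qed
  then show ?thesis by (rule pivot_monom_subset) (use A in auto)
qed

lemma admissible_pivot_monom_in:
  assumes n: "pivot n \<in> J" "1 \<le> n" and m: "n + 4 \<le> m" and A: "admissible CHAR('k) m A"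
  shows "pivot_monom A m \<in> J"
proof -
  define i where "i = m - 4"
  have i: "m = i + 4" using m unfolding i_def by simp
  have A': "A \<subseteq> {..<i + 4}"
    "i + 3 \<in> A \<longrightarrow> i + 2 \<notin> A \<and> (CHAR('k) = 2 \<longrightarrow> A = {i + 3})"
    using A spec[of "\<lambda>j. m = j + 2 \<longrightarrow> j + 1 \<in> A \<longrightarrow> j \<notin> A \<and> (CHAR('k) = 2 \<longrightarrow> A = {j + 1})" "i + 2"]
    unfolding admissible_def i by (simp_all add: numeral_3_eq_3)
  show ?thesis
  proof (cases "i + 3 \<in> A")
    case False
    have "a < i + 3" if "a \<in> A" for a
    proof -
      have "a \<noteq> i + 3" "a < i + 4" using A'(1) False that by auto
      then show ?thesis by simp
    qed
    then have "A \<subseteq> {..<i + 3}" by blast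
    then have "pivot_monom A (i + 3 + 1) \<in> J" using m i by (intro pivot_monom_initial_in[OF n]) auto
    then show ?thesis using i by (simp add: add.commute)
  next
    case True
    then have *: "i + 2 \<notin> A" "CHAR('k) = 2 \<Longrightarrow> A = {i + 3}" "A \<subseteq> {..<i + 4}"
      using A' by auto
    show ?thesis
    proof (cases "CHAR('k) = 2")
      case True
      have p: "pivot (i + 2) \<in> J" using m i by (intro pivot_in_up[OF n]) auto
      then have "pivot (i + 2) ^ 2 \<in> J"
        using J True ehom_pivot unfolding lie_ideal_def by blast
      then have "pivot_monom {i + 2 + 1} (i + 2 + 2) \<in> J"
        using ideal_subspace p sbracket_pivot_in[OF p] by (intro pivot_square_in) simp_all
      then show ?thesis using *(2)[OF True] i by (simp add: numeral_eq_Suc)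
    next
      case False
      \<comment> \<open>Bracketing this element with \<open>v_i\<close> gives the monomial in all
        letters below \<open>m\<close> except \<open>i + 2\<close>, in front of \<open>v_m\<close>.
        It requires \<open>n \<le> i = m - 4\<close>, hence the bound \<open>n + 4\<close>.\<close>
      have "pivot_monom {..<i} (i + 1 + 1) \<in> J" using m i
        by (intro pivot_monom_initial_in[OF n]) auto
      then have "pivot_monom {..<i} (i + 2 * 1) \<in> J" by (simp add: numeral_eq_Suc)
      then have "pivot_monom ({..<i} \<union> ({i..<i + 2 * 1} \<union> {i + 2 * 1 + 1})) (i + 2 * 1 + 2) \<in> J"
        using False by (intro pivot_monom_extend_even) auto
      then have "pivot_monom A (i + 2 * 1 + 2) \<in> J"
      proof (rule pivot_monom_subset)
        show "A \<subseteq> {..<i} \<union> ({i..<i + 2 * 1} \<union> {i + 2 * 1 + 1})"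
        proof
          fix a assume "a \<in> A"
          then have "a < i + 4" "a \<noteq> i + 2" using * by auto
          then show "a \<in> {..<i} \<union> ({i..<i + 2 * 1} \<union> {i + 2 * 1 + 1})" by auto
        qed
      qed auto
      then show ?thesis using i by (simp add: numeral_eq_Suc)
    qed
  qed
qed

text \<open>The admissible span is contained in \<open>J\<close> plus the span of the finitely many
  \<open>x_A v_m\<close> with \<open>m < n + 4\<close>.\<close>

lemma finite_codimension_if_pivot_in:
  assumes n: "pivot n \<in> J" "1 \<le> n"
  shows "finite_codimension J pivot_superalgebra"
proof -
  let ?R = "pivot_superalgebra :: 'k grend set"
  define G where "G = (\<lambda>(A, m). pivot_monom A m :: 'k grend) ` (Pow {..<n + 4} \<times> {..<n + 4})"
  have "finite G" unfolding G_def by simp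
  have subR: "gend.subspace ?R"
    using lie_subsuperalgebra_pivot_superalgebra
      unfolding lie_subsuperalgebra_def graded_subspace_def by blast
  have "J \<subseteq> ?R" using J unfolding lie_ideal_def by blast
  have sub: "gend.subspace {E + F |E F. E \<in> gend.span G \<and> F \<in> J}"
    by (rule gend.subspace_sums[OF gend.subspace_span ideal_subspace])
  have "pivot_monom A m \<in> {E + F |E F. E \<in> gend.span G \<and> F \<in> J}" if "admissible CHAR('k) m A" for A m
  proof (cases "m < n + 4")
    case True
    then have "pivot_monom A m \<in> G"
      using that unfolding admissible_def G_def by (intro image_eqI[of _ _ "(A, m)"]) auto
    then show ?thesis
      using gend.span_base gend.subspace_0[OF ideal_subspace]
        by (intro CollectI exI[of _ "pivot_monom A m"] exI[of _ 0]) auto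
  next
    case False
    then have "pivot_monom A m \<in> J" using that by (intro admissible_pivot_monom_in[OF n]) auto
    then show ?thesis
      using gend.span_zero by (intro CollectI exI[of _ 0] exI[of _ "pivot_monom A m"]) auto
  qed
  then have split: "admissible_span \<subseteq> {E + F |E F. E \<in> gend.span G \<and> F \<in> J}"
    unfolding admissible_span_def by (intro gend.span_minimal sub) blast
  \<comment> \<open>The elements of \<open>G\<close> may lie outside the algebra, so a basis of the
    intersection of the algebra with their span is taken; it is finite because it is independent
    inside a finite-dimensional space.\<close>
  obtain B where B: "B \<subseteq> ?R \<inter> gend.span G" "gend.independent B" "?R \<inter> gend.span G \<subseteq> gend.span B"
    using gend.maximal_independent_subset by blast
  then have "finite B" using gend.independent_span_bound[OF \<open>finite G\<close>, of B] by blast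
  moreover have "\<exists>E\<in>gend.span B. D - E \<in> J" if D: "D \<in> ?R" for D
  proof -
    obtain E F where EF: "D = E + F" "E \<in> gend.span G" "F \<in> J"
      using D split pivot_superalgebra_subset by blast
    then have "E \<in> ?R"
      using gend.subspace_diff[OF subR D, of F] \<open>J \<subseteq> ?R\<close> by auto
    then show ?thesis using EF B(3) by (intro bexI[of _ E]) auto
  qed
  ultimately show ?thesis using B(1) unfolding finite_codimension_def by blast
qed

text \<open>Bracketing with \<open>v\<^sub>i\<close> turns \<open>g\<close> into \<open>v\<^sub>i(g)\<close>, but also produces a term free of
  \<open>x\<^sub>M\<close>; bracketing further with \<open>v\<^bsub>M+1\<^esub>\<close> and \<open>v\<^sub>M\<close> removes that term.\<close>

lemma triple_bracket_in:
  assumes E: "lmult (g * gx M) * pivot (M + 2) \<in> J"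
    and g: "g \<in> grassmann_below M" and i: "i < M"
  shows "lmult (app (pivot i) g * gx (M + 1)) * pivot (M + 3) \<in> J"
proof -
  note br = sbracket_odd_lmult[OF odd_superderivation_pivot ehom_pivot]
  note der = app_odd_superderivation_mult[OF odd_superderivation_pivot]
  define u where "u = app (pivot i) g"
  define r where "r = ginvol g * app (pivot i) (gx M)"
  have u: "u \<in> grassmann_below M" unfolding u_def by (rule grassmann_below_pivot[OF g])
  have r: "r \<in> grassmann_below M"
    unfolding r_def by (intro grassmann_below_mult grassmann_below_ginvol g pivot_gx_even i)
  have f1: "u * gx M + r \<in> grassmann_below (M + 1)"
    using u r by (auto intro!: grassmann_below_add grassmann_below_mult grassmann_below_gx
        elim: grassmann_below_mono)
  have "sbracket (pivot i) (lmult (g * gx M) * pivot (M + 2)) = lmult (u * gx M + r) * pivot (M + 2)"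
    using i lmult_gx_anticomm_pivot_eq_0[of i M "M + 2" "- ginvol g" 1]
    by (simp add: br der ginvol_mult ginvol_gx u_def r_def)
  then have 1: "lmult (u * gx M + r) * pivot (M + 2) \<in> J"
    using sbracket_pivot_in[OF E, of i] by simp
  define s where "s = ginvol (u * gx M + r)"
  have s: "s \<in> grassmann_below (M + 1)" unfolding s_def by (rule grassmann_below_ginvol[OF f1])
  have "sbracket (pivot (M + 1)) (lmult (u * gx M + r) * pivot (M + 2)) =
      - (lmult (s * gx (M + 1)) * pivot (M + 3))"
    using pivot_below_eq_0[OF f1, of "M + 1"] anticomm_pivot_Suc[of "M + 1", where 'a = 'k]
    by (simp add: br s_def lmult_mult mult.assoc numeral_eq_Suc)
  then have "- (lmult (s * gx (M + 1)) * pivot (M + 3)) \<in> J"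
    using sbracket_pivot_in[OF 1, of "M + 1"] by simp
  then have 2: "lmult (s * gx (M + 1)) * pivot (M + 3) \<in> J"
    using gend.subspace_neg[OF ideal_subspace] by fastforce
  have "app (pivot M) (gx (M + 1)) = (0 :: 'k grassmann)" by (rule pivot_gx_odd) simp
  moreover have "app (pivot M) s = - u"
  proof -
    have "app (pivot M) (ginvol u) = 0" "app (pivot M) (ginvol r) = 0"
      using u r by (auto intro: pivot_below_eq_0 grassmann_below_ginvol)
    then show ?thesis
      unfolding s_def by (simp add: ginvol_add ginvol_mult ginvol_gx app_add der pivot_gx_self app_diff)
  qed
  ultimately have "sbracket (pivot M) (lmult (s * gx (M + 1)) * pivot (M + 3)) =
      lmult (- u * gx (M + 1)) * pivot (M + 3)"
    using lmult_gx_anticomm_pivot_eq_0[of M "M + 1" "M + 3" "- ginvol s" 1]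
    by (simp add: br der ginvol_mult ginvol_gx)
  then have "- (lmult (u * gx (M + 1)) * pivot (M + 3)) \<in> J"
    using sbracket_pivot_in[OF 2, of M] by (simp add: lmult_uminus)
  then show ?thesis
    using gend.subspace_neg[OF ideal_subspace] unfolding u_def by fastforce
qed

text \<open>Induction on the bound for the letters of \<open>g\<close>. If the letter
  \<open>i\<close> occurs, \<open>triple_bracket_in\<close> replaces \<open>g\<close> by
  \<open>v_i(g)\<close>, which is the nonzero derivative by \<open>x_i\<close> and lies in letters
  below \<open>i\<close>. A constant \<open>g\<close> leaves \<open>x_M v_(M+2)\<close>, from which
  \<open>x_M\<close> is stripped.\<close>

lemma pivot_in_if_lmult_gx_in:
  assumes "lmult (g * gx M) * pivot (M + 2) \<in> J" "g \<in> grassmann_below i" "i \<le> M" "g \<noteq> 0"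
  obtains n where "1 \<le> n" "pivot n \<in> J"
proof -
  have "\<exists>n\<ge>1. pivot n \<in> J"
    using assms
  proof (induction i arbitrary: g M)
    case 0
    then have g: "g = gscale (coef g {}) 1" by (intro grassmann_below_0_const)
    then have "coef g {} \<noteq> 0" using 0 by (metis gr.scale_zero_left)
    have "lmult (g * gx M) * pivot (M + 2) = escale (coef g {}) (pivot_monom {M} (M + 2))"
      by (subst g) (simp add: gscale_mult_left lmult_gscale escale_mult_left pivot_monom_def gx_def)
    then have "pivot_monom {M} (M + 2) \<in> J"
      using 0(1) \<open>coef g {} \<noteq> 0\<close> escale_in_iff by simp
    then have "pivot (M + 2) \<in> J" using pivot_monom_strip[of "{M}" "M + 2" M] by simp
    then show ?case by (intro exI[of _ "M + 2"]) simp
  next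
    case (Suc i)
    have gM: "g \<in> grassmann_below M" using Suc.prems by (auto elim: grassmann_below_mono)
    show ?case
    proof (cases "app (gderiv i) g = 0")
      case True
      have "g \<in> grassmann_below i"
        unfolding grassmann_below_def
      proof (intro CollectI allI impI)
        fix A assume A: "coef g A \<noteq> 0"
        have "i \<notin> A"
        proof
          assume "i \<in> A"
          then have "coef (app (gderiv i) g) (A - {i}) \<noteq> 0"
            using A by (simp add: coef_gderiv insert_absorb)
          then show False using True by simp
        qed
        then show "A \<subseteq> {..<i}"
          using grassmann_belowD[OF Suc.prems(2) A] by (auto simp: less_Suc_eq)
      qed
      then show ?thesis using Suc by auto
    next
      case False
      have eq: "app (pivot i) g = app (gderiv i) g"
        using Suc.prems(2) by (intro pivot_eq_gderiv) (auto elim: grassmann_below_mono)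
      have "lmult (app (pivot i) g * gx (M + 1)) * pivot (M + 1 + 2) \<in> J"
        using triple_bracket_in[OF Suc.prems(1) gM, of i] Suc.prems(3) by (simp add: numeral_eq_Suc)
      moreover have "app (pivot i) g \<in> grassmann_below i"
        unfolding eq by (rule grassmann_below_gderiv[OF Suc.prems(2)])
      ultimately show ?thesis
        using Suc.IH[of "app (pivot i) g" "M + 1"] Suc.prems(3) False eq by simp
    qed
  qed
  then show thesis using that by blast
qed

end

section \<open>Nonzero ideals contain a pivot element\<close>

lemma sbracket_uminus_right: "sbracket D (- E) = - sbracket D E"
  using sbracket_add_right[of D E "- E"] by (simp add: eq_neg_iff_add_eq_0 add.commute)

text \<open>Two neighbouring pivots are kept because the recursion for \<open>v_N\<close> jumps to
  \<open>v_(N+2)\<close>; this lets \<open>N\<close> be raised by one at a time, so that elements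
  can be brought to a common \<open>N\<close>.\<close>

definition pivot_expansion ::
    "nat \<Rightarrow> (nat \<Rightarrow> 'k::field grassmann) \<Rightarrow> 'k grassmann \<Rightarrow> 'k grassmann \<Rightarrow> 'k grend" where
  "pivot_expansion N h f g =
     (\<Sum>n<N. lmult (h n) * gderiv n) + lmult f * pivot N + lmult g * pivot (N + 1)"

definition expansion_below :: "nat \<Rightarrow> 'k::field grend set" where
  "expansion_below N = {pivot_expansion N h f g |h f g.
     (\<forall>n. h n \<in> grassmann_below n) \<and> f \<in> grassmann_below N \<and> g \<in> grassmann_below (N + 1)}"

text \<open>Expanding \<open>v_N\<close> once moves \<open>f\<close> to the coefficient of
  \<open>gderiv N\<close>, and \<open>v_(N+1)\<close> becomes the first of the two pivots.\<close>

lemma pivot_expansion_Suc: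
  "pivot_expansion N h f g =
    pivot_expansion (N + 1) (h(N := f)) g (f * (gx N * gx (N + 1)))"
proof -
  have "lmult f * pivot N = lmult f * gderiv N + lmult (f * (gx N * gx (N + 1))) * pivot (N + 2)"
    by (subst pivot_rec') (simp add: distrib_left lmult_mult mult.assoc)
  moreover have "(\<Sum>n<N. lmult ((h(N := f)) n) * gderiv n) = (\<Sum>n<N. lmult (h n) * gderiv n)"
    by (intro sum.cong) auto
  ultimately show ?thesis
    unfolding pivot_expansion_def by (simp add: add_ac)
qed

lemma expansion_below_Suc: "D \<in> expansion_below N \<Longrightarrow> D \<in> expansion_below (Suc N)"
proof -
  assume "D \<in> expansion_below N"
  then obtain h f g where *: "D = pivot_expansion N h f g" "\<And>n. h n \<in> grassmann_below n"
    "f \<in> grassmann_below N" "g \<in> grassmann_below (N + 1)"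
    unfolding expansion_below_def by blast
  have "f * (gx N * gx (N + 1)) \<in> grassmann_below (Suc N + 1)"
    by (intro grassmann_below_mult grassmann_below_mono[OF *(3)] grassmann_below_gx) auto
  then show ?thesis
    unfolding expansion_below_def using * pivot_expansion_Suc[of N h f g]
    by (intro CollectI exI[of _ "h(N := f)"] exI[of _ g] exI[of _ "f * (gx N * gx (N + 1))"]) auto
qed

lemma expansion_below_mono:
  assumes "D \<in> expansion_below N" "N \<le> M"
  shows "D \<in> expansion_below M"
  using assms(2) by (induction rule: dec_induct) (simp_all add: assms(1) expansion_below_Suc)

lemma expansion_below_add:
  assumes "D \<in> expansion_below N" "E \<in> expansion_below N"
  shows "escale c D + E \<in> expansion_below N"
proof -
  obtain h f g where 1: "D = pivot_expansion N h f g" "\<And>n. h n \<in> grassmann_below n"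
    "f \<in> grassmann_below N" "g \<in> grassmann_below (N + 1)"
    using assms(1) unfolding expansion_below_def by blast
  obtain h' f' g' where 2: "E = pivot_expansion N h' f' g'" "\<And>n. h' n \<in> grassmann_below n"
    "f' \<in> grassmann_below N" "g' \<in> grassmann_below (N + 1)"
    using assms(2) unfolding expansion_below_def by blast
  have "escale c D + E = pivot_expansion N (\<lambda>n. gscale c (h n) + h' n) (gscale c f + f') (gscale c g + g')"
    unfolding 1(1) 2(1) pivot_expansion_def
    by (simp add: lmult_add lmult_gscale distrib_right sum.distrib escale_mult_left
        gend.scale_right_distrib gend.scale_sum_right add_ac)
  then show ?thesis
    unfolding expansion_below_def using 1 2
    by (intro CollectI exI[of _ "\<lambda>n. gscale c (h n) + h' n"] exI[of _ "gscale c f + f'"]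
        exI[of _ "gscale c g + g'"]) (simp add: grassmann_below_add grassmann_below_gscale)
qed

lemma zero_in_expansion_below: "0 \<in> expansion_below N"
  unfolding expansion_below_def pivot_expansion_def
  by (intro CollectI exI[of _ "\<lambda>_. 0"] exI[of _ 0]) (simp add: grassmann_below_zero)

lemma admissible_span_expansion:
  assumes "D \<in> (admissible_span :: 'k::field grend set)"
  obtains N where "D \<in> expansion_below N"
proof -
  have "\<exists>N. D \<in> expansion_below N"
    using assms unfolding admissible_span_def
  proof (induction D rule: gend.span_induct_alt)
    case base
    then show ?case using zero_in_expansion_below by blast
  next
    case (step c x y)
    then obtain A n N where x: "x = pivot_monom A n" "A \<subseteq> {..<n}" and y: "y \<in> expansion_below N"
      unfolding admissible_def by blast
    have "x \<in> expansion_below n"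
      unfolding expansion_below_def pivot_expansion_def x(1) pivot_monom_def using x(2)
      by (intro CollectI exI[of _ "\<lambda>_. 0"] exI[of _ "monom A"] exI[of _ 0])
        (simp add: grassmann_below_zero grassmann_below_monom)
    then have "escale c x + y \<in> expansion_below (max n N)"
      using y by (intro expansion_below_add) (auto elim: expansion_below_mono)
    then show ?case by blast
  qed
  then show thesis using that by blast
qed

text \<open>High pivots do not see the derivative part: they kill the coefficients
  \<open>h n\<close> and anticommute with \<open>gderiv n\<close> for \<open>n < m\<close>.\<close>

lemma sbracket_pivot_gderiv_sum:
  assumes "\<And>n. h n \<in> grassmann_below n" "N \<le> m"
  shows "sbracket (pivot m) (\<Sum>n<N. lmult (h n) * gderiv n) = (0 :: 'k::field grend)"
  unfolding sbracket_sum_right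
proof (rule sum.neutral, rule ballI)
  fix n assume "n \<in> {..<N}"
  then have "app (pivot m) (h n) = 0" "anticomm (pivot m) (gderiv n) = (0 :: 'k grend)"
    using pivot_below_eq_0[OF assms(1)] anticomm_gderiv_pivot[of n m] assms(2)
    by (auto simp: anticomm_commute)
  then show "sbracket (pivot m) (lmult (h n) * gderiv n) = 0"
    by (simp add: sbracket_odd_lmult[OF odd_superderivation_pivot ehom_gderiv])
qed

context
  fixes J :: "'k::field grend set"
  assumes J: "lie_ideal J pivot_superalgebra"
begin

lemma uminus_in_ideal: "- D \<in> J \<Longrightarrow> D \<in> J"
  using gend.subspace_neg[OF ideal_subspace[OF J]] by fastforce

text \<open>With \<open>N\<close> the last index where \<open>h N \<noteq> 0\<close>, the bracket
  with \<open>v_N\<close> kills all earlier terms and leaves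
  \<open>u x_(N+1) v_(N+2)\<close>.\<close>

lemma pivot_in_if_gderiv_sum_in:
  assumes "(\<Sum>n<N. lmult (h n) * gderiv n) \<in> J" "(\<Sum>n<N. lmult (h n) * gderiv n) \<noteq> 0"
    and h: "\<And>n. h n \<in> grassmann_below n"
  shows "\<exists>n\<ge>1. pivot n \<in> J"
  using assms(1,2)
proof (induction N)
  case (Suc N)
  show ?case
  proof (cases "h N = 0")
    case False
    note br = sbracket_odd_lmult[OF odd_superderivation_pivot]
    define u where "u = ginvol (h N)"
    have u: "u \<in> grassmann_below N" "u \<noteq> 0"
      using h False unfolding u_def by (auto intro: grassmann_below_ginvol)
    have "sbracket (pivot N) (\<Sum>n<Suc N. lmult (h n) * gderiv n) =
        lmult u * anticomm (pivot N) (gderiv N)"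
      using sbracket_pivot_gderiv_sum[of h N N, OF h] pivot_below_eq_0[OF h[of N], of N]
      by (simp add: sbracket_add_right br[OF ehom_gderiv] u_def)
    also have "\<dots> = lmult (u * gx (N + 1)) * pivot (N + 2)"
      using anticomm_gderiv_pivot_self[of N, where 'a = 'k]
      by (simp add: anticomm_commute lmult_mult mult.assoc)
    finally have 1: "lmult (u * gx (N + 1)) * pivot (N + 2) \<in> J"
      using sbracket_pivot_in[OF J Suc.prems(1), of N] by simp
    have "app (pivot (N + 1)) u = 0" using pivot_below_eq_0[OF u(1), of "N + 1"] by simp
    then have "sbracket (pivot (N + 1)) (lmult (u * gx (N + 1)) * pivot (N + 2)) =
        lmult (ginvol u) * pivot (N + 2)"
      using lmult_gx_anticomm_pivot_eq_0[of "N + 1" "N + 1" "N + 2" "- ginvol u" 1]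
        pivot_gx_self[of "N + 1", where 'a = 'k]
      by (simp add: br[OF ehom_pivot] app_odd_superderivation_mult[OF odd_superderivation_pivot]
          ginvol_mult ginvol_gx)
    then have 2: "lmult (ginvol u) * pivot (N + 2) \<in> J"
      using sbracket_pivot_in[OF J 1, of "N + 1"] by simp
    have "app (pivot (N + 1)) (ginvol u) = 0"
      using pivot_below_eq_0[OF grassmann_below_ginvol[OF u(1)], of "N + 1"] by simp
    \<comment> \<open>The letter \<open>x_(N+1)\<close> returns, now in front of
      \<open>v_(N+3)\<close>, which is the shape needed with \<open>M = N + 1\<close>.\<close>
    then have "sbracket (pivot (N + 1)) (lmult (ginvol u) * pivot (N + 2)) =
        - (lmult (u * gx (N + 1)) * pivot (N + 3))"
      using anticomm_pivot_Suc[of "N + 1", where 'a = 'k]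
      by (simp add: br[OF ehom_pivot] lmult_mult mult.assoc numeral_eq_Suc)
    then have "- (lmult (u * gx (N + 1)) * pivot (N + 3)) \<in> J"
      using sbracket_pivot_in[OF J 2, of "N + 1"] by simp
    then have "lmult (u * gx (N + 1)) * pivot (N + 3) \<in> J" by (rule uminus_in_ideal)
    then have "lmult (u * gx (N + 1)) * pivot (N + 1 + 2) \<in> J" by (simp add: numeral_eq_Suc)
    then obtain n where "1 \<le> n" "pivot n \<in> J"
      by (rule pivot_in_if_lmult_gx_in[OF J _ u(1) _ u(2)]) simp_all
    then show ?thesis by blast
  qed (use Suc in simp)
qed simp

text \<open>The bracket with \<open>v_(N+1)\<close> kills the derivative part. A second one kills
  the contribution of \<open>g\<close> and turns that of \<open>f\<close> into
  \<open>f x_N x_(N+1) v_(N+3)\<close> up to sign; finally \<open>v_N\<close> strips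
  \<open>x_N\<close>.\<close>

lemma pivot_in_if_expansion_in:
  assumes D: "pivot_expansion N h f g \<in> J" and h: "\<And>n. h n \<in> grassmann_below n"
    and f: "f \<in> grassmann_below N" "f \<noteq> 0" and g: "g \<in> grassmann_below (N + 1)"
  shows "\<exists>n\<ge>1. pivot n \<in> J"
proof -
  note br = sbracket_odd_lmult[OF odd_superderivation_pivot ehom_pivot]
  note der = app_odd_superderivation_mult[OF odd_superderivation_pivot]
  define u where "u = ginvol f"
  define s where "s = gscale 2 (ginvol g)"
  have u: "u \<in> grassmann_below N" "u \<noteq> 0"
    using f unfolding u_def by (auto intro: grassmann_below_ginvol)
  have s: "s \<in> grassmann_below (N + 1)"
    unfolding s_def by (intro grassmann_below_gscale grassmann_below_ginvol g)
  have ux: "u * gx N \<in> grassmann_below (N + 1)"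
    by (intro grassmann_below_mult grassmann_below_mono[OF u(1)] grassmann_below_gx) auto
  have "anticomm (pivot (N + 1)) (pivot N) = - (lmult (gx N) * pivot (N + 2) :: 'k grend)"
    using anticomm_pivot_Suc[of N, where 'a = 'k] by (simp add: anticomm_commute)
  moreover have "anticomm (pivot (N + 1)) (pivot (N + 1)) =
      escale 2 (lmult (gx (N + 2)) * pivot (N + 3) :: 'k grend)"
    using anticomm_pivot_even[of "N + 1" 0, where 'a = 'k] by (simp add: gx_def numeral_eq_Suc)
  ultimately have "sbracket (pivot (N + 1)) (pivot_expansion N h f g) =
      - (lmult (u * gx N) * pivot (N + 2)) + lmult (s * gx (N + 2)) * pivot (N + 3)"
    using sbracket_pivot_gderiv_sum[of h N "N + 1", OF h] pivot_below_eq_0[OF f(1), of "N + 1"]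
      pivot_below_eq_0[OF g, of "N + 1"]
    unfolding pivot_expansion_def sbracket_add_right br
    by (simp only: u_def s_def lmult_mult mult.assoc lmult_gscale escale_mult_left escale_mult_right
        gscale_mult_left mult_minus_right le_add1 order_refl lmult_zero mult_zero_left add_0)
  then have 1: "- (lmult (u * gx N) * pivot (N + 2)) + lmult (s * gx (N + 2)) * pivot (N + 3) \<in> J"
    using sbracket_pivot_in[OF J D, of "N + 1"] by simp
  \<comment> \<open>\<open>v_(N+1)\<close> vanishes on \<open>s\<close> and on
    \<open>x_(N+2)\<close>, and \<open>[v_(N+1), v_(N+3)]\<close> is divisible by
    \<open>x_(N+2)\<close>.\<close>
  have "sbracket (pivot (N + 1)) (lmult (s * gx (N + 2)) * pivot (N + 3)) = 0"
  proof -
    have "app (pivot (N + 1)) (gx (N + 2)) = (0 :: 'k grassmann)" by (rule pivot_gx_odd) simp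
    then show ?thesis
      using pivot_below_eq_0[OF s, of "N + 1"]
        lmult_gx_anticomm_pivot_eq_0[of "N + 1" "N + 2" "N + 3" "- ginvol s" 1]
      by (simp add: br der ginvol_mult ginvol_gx)
  qed
  moreover have "sbracket (pivot (N + 1)) (lmult (u * gx N) * pivot (N + 2)) =
      lmult (f * gx N * gx (N + 1)) * pivot (N + 3)"
  proof -
    have "ginvol (u * gx N) = - (f * gx N)"
      unfolding u_def by (simp add: ginvol_mult ginvol_gx)
    moreover have "anticomm (pivot (N + 1)) (pivot (N + 2)) = - (lmult (gx (N + 1)) * pivot (N + 3) :: 'k grend)"
      using anticomm_pivot_Suc[of "N + 1", where 'a = 'k] by (simp add: numeral_eq_Suc)
    ultimately show ?thesis
      using pivot_below_eq_0[OF ux, of "N + 1"] unfolding br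
        by (simp add: lmult_uminus lmult_mult mult.assoc)
  qed
  ultimately have "- (lmult (f * gx N * gx (N + 1)) * pivot (N + 3)) \<in> J"
    using sbracket_pivot_in[OF J 1, of "N + 1"]
    unfolding sbracket_add_right sbracket_uminus_right by simp
  then have 2: "lmult (f * gx N * gx (N + 1)) * pivot (N + 3) \<in> J" by (rule uminus_in_ideal)
  have "app (pivot N) (gx (N + 1)) = (0 :: 'k grassmann)" by (rule pivot_gx_odd) simp
  then have "app (pivot N) (f * gx N * gx (N + 1)) = u * gx (N + 1)"
    using pivot_below_eq_0[OF f(1), of N] by (simp add: der pivot_gx_self u_def)
  then have "sbracket (pivot N) (lmult (f * gx N * gx (N + 1)) * pivot (N + 3)) =
      lmult (u * gx (N + 1)) * pivot (N + 3)"
    using lmult_gx_anticomm_pivot_eq_0[of N N "N + 3" "ginvol f" "gx (N + 1)"]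
    by (simp add: br ginvol_mult ginvol_gx)
  then have "lmult (u * gx (N + 1)) * pivot (N + 1 + 2) \<in> J"
    using sbracket_pivot_in[OF J 2, of N] by (simp add: numeral_eq_Suc)
  then obtain n where "1 \<le> n" "pivot n \<in> J"
    by (rule pivot_in_if_lmult_gx_in[OF J _ u(1) _ u(2)]) simp_all
  then show ?thesis by blast
qed

lemma pivot_in_nonzero_ideal:
  assumes "J \<noteq> {0}"
  shows "\<exists>n\<ge>1. pivot n \<in> J"
proof -
  obtain D where D: "D \<in> J" "D \<noteq> 0"
    using assms gend.subspace_0[OF ideal_subspace[OF J]] by blast
  moreover have "J \<subseteq> admissible_span"
    using J pivot_superalgebra_subset unfolding lie_ideal_def by blast
  ultimately obtain N where "D \<in> expansion_below N" by (metis admissible_span_expansion subsetD)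
  then obtain h f g where e: "D = pivot_expansion N h f g" "\<And>n. h n \<in> grassmann_below n"
    "f \<in> grassmann_below N" "g \<in> grassmann_below (N + 1)"
    unfolding expansion_below_def by blast
  show ?thesis
  proof (cases "f = 0")
    case False
    then show ?thesis using pivot_in_if_expansion_in[of N h f g] D e by blast
  next
    case True
    show ?thesis
    proof (cases "g = 0")
      case True
      then have "D = (\<Sum>n<N. lmult (h n) * gderiv n)"
        using e(1) \<open>f = 0\<close> unfolding pivot_expansion_def by simp
      then show ?thesis using pivot_in_if_gderiv_sum_in[of h N] D e by blast
    next
      case False
      \<comment> \<open>Raising \<open>N\<close> by one puts the nonzero \<open>g\<close> into the
        place of the leading coefficient \<open>f\<close>.\<close>
      have "D = pivot_expansion (N + 1) (h(N := 0)) g 0"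
        using e(1) \<open>f = 0\<close> pivot_expansion_Suc[of N h 0 g] by simp
      moreover have "(h(N := 0)) n \<in> grassmann_below n" for n using e(2)
        by (simp add: grassmann_below_zero)
      ultimately show ?thesis
        using pivot_in_if_expansion_in[of "N + 1" "h(N := 0)" g 0] D(1) e(4) False grassmann_below_zero
        by metis
    qed
  qed
qed

end

section \<open>Infinite dimension\<close>

lemma app_sum_left: "app (\<Sum>i\<in>S. D i) f = (\<Sum>i\<in>S. app (D i) f)"
  by (induction S rule: infinite_finite_induct) simp_all

lemma app_pivot_gx_less: "n < i \<Longrightarrow> app (pivot i) (gx n) = 0"
  by (rule pivot_below_eq_0[of _ i]) (simp_all add: grassmann_below_gx)

lemma inj_pivot: "inj (pivot :: nat \<Rightarrow> 'k::field grend)"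
proof (rule injI)
  fix i j assume eq: "pivot i = (pivot j :: 'k grend)"
  show "i = j"
  proof (rule ccontr)
    assume "i \<noteq> j"
    then have "app (pivot i) (gx i) \<noteq> (app (pivot j) (gx i) :: 'k grassmann) \<or>
        app (pivot i) (gx j) \<noteq> (app (pivot j) (gx j) :: 'k grassmann)"
      by (cases i j rule: linorder_cases) (simp_all add: pivot_gx_self app_pivot_gx_less)
    then show False using eq by simp
  qed
qed

text \<open>The values on the letters are triangular: \<open>v_n(x_n) = 1\<close>, and
  \<open>v_i(x_n) = 0\<close> for \<open>i > n\<close>. Evaluating a relation at \<open>x_n\<close>,
  with \<open>n\<close> the least index whose coefficient is nonzero, isolates that
  coefficient.\<close>

lemma independent_pivots: "gend.independent (range (pivot :: nat \<Rightarrow> 'k::field grend))"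
  unfolding gend.independent_explicit_module
proof (intro allI impI, rule ccontr)
  fix t u and v :: "'k grend"
  assume t: "finite t" "t \<subseteq> range pivot" and 0: "(\<Sum>v\<in>t. escale (u v) v) = 0" and v: "v \<in> t" "u v \<noteq> 0"
  obtain I where I: "t = pivot ` I" "finite I"
    using t by (metis finite_subset_image)
  define K where "K = {i \<in> I. u (pivot i) \<noteq> 0}"
  have "finite K" "K \<noteq> {}" using I v unfolding K_def by auto
  define n where "n = Min K"
  have n: "n \<in> I" "u (pivot n) \<noteq> 0"
    using Min_in[OF \<open>finite K\<close> \<open>K \<noteq> {}\<close>] unfolding n_def K_def by auto
  have "(\<Sum>i\<in>I. escale (u (pivot i)) (pivot i)) = 0"
    using 0 unfolding I(1) by (subst (asm) sum.reindex) (auto intro: inj_on_subset[OF inj_pivot])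
  then have "(\<Sum>i\<in>I. gscale (u (pivot i)) (app (pivot i) (gx n))) = 0"
    using app_sum_left[of "\<lambda>i. escale (u (pivot i)) (pivot i)" I "gx n"]
      by (simp add: escale.rep_eq)
  moreover have "gscale (u (pivot i)) (app (pivot i) (gx n)) = (if i = n then gscale (u (pivot n)) 1 else 0)"
    if "i \<in> I" for i
  proof (cases "i \<in> K")
    case True
    then have "n \<le> i" unfolding n_def using \<open>finite K\<close> by simp
    then show ?thesis by (auto simp: pivot_gx_self app_pivot_gx_less)
  qed (use that n in \<open>auto simp: K_def\<close>)
  ultimately have "gscale (u (pivot n)) 1 = (0 :: 'k grassmann)"
    using I(2) n(1) by simp
  then show False using n(2) by (simp add: gr.scale_eq_0_iff)
qed

lemma infinite_dimensional_pivot_superalgebra: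
  "\<not> finite_dimensional (pivot_superalgebra :: 'k::field grend set)"
proof
  assume "finite_dimensional (pivot_superalgebra :: 'k grend set)"
  then obtain B :: "'k grend set" where "finite B" "gend.span B = pivot_superalgebra"
    unfolding finite_dimensional_def by blast
  then have "finite (range (pivot :: nat \<Rightarrow> 'k grend))"
    using gend.independent_span_bound[OF _ independent_pivots] pivot_in_pivot_superalgebra by blast
  then show False using finite_imageD[OF _ inj_pivot] infinite_UNIV_nat by blast
qed

theorem theorem13p1:
  shows "just_infinite (pivot_superalgebra :: 'k::field grend set)"
  unfolding just_infinite_def
  using infinite_dimensional_pivot_superalgebra pivot_in_nonzero_ideal finite_codimension_if_pivot_in
  by blast

end
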